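(* Let $\{Z_n:n\geq 0\}$ be a critical Galton--Watson process in a varying environment $Q=\{q_n:n\ge1\}$, i.e. a regular one with $\rho_{0,n}\to\infty$ and $\mu_n\rho_{0,n}\to\infty$ as $n\to\infty$. Assume that there exists $c>0$ such that $$f_n'''(1)\leq c\, f_n''(1)\,(1+f_n'(1))\qquad\text{for any } n\geq 1,$$ and define $b_n:=\mathbb{E}[Z_n\mid Z_n>0]$, $n\geq0$. Assume that there exists $a>0$ such that $f_n''(1)\geq a$ for all $n\geq1$. Let $\mathfrak{M}_n:=\sup_{1\leq k\leq n}f_k'(1)$ for $n\geq1$ and $$s_n:=\sum_{k=2}^{n-1}\left(\log(\rho_{0,k}\mu_k)+\log\left(f_k'(1)\right)\right)\left|\frac{1}{\mu_{k-2}}-\frac{1}{\mu_k}\right|,\qquad n\geq3.$$ Then $$d_W\left(\left\{\left.\frac{1}{b_n}Z_n\ \right|\ Z_n>0\right\},\mathbf{e}\right)\leq C(1+\mathfrak{M}_n)^5\left(\frac{\log(\mu_n\rho_{0,n})+\log(f_n'(1))}{\mu_n\rho_{0,n}}+\frac{s_n}{\rho_{0,n}}\right),$$ where $\mathbf{e}$ is a standard exponentially distributed random variable and $C>0$ is a constant which is independent of $n$.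
   Context: An environment is a sequence $Q=\{q_n:n\geq1\}$ of probability measures on $\mathbb{N}_0=\{0,1,2,\dots\}$. The Galton--Watson process in the varying environment $Q$ (GWVE) is defined by $Z_0=1$ and $Z_n=\sum_{i=1}^{Z_{n-1}}\chi_i^{(n)}$, $n\geq1$, where $\{\chi_i^{(n)}:i,n\geq1\}$ are independent and $\chi_i^{(n)}$ has law $q_n$. It is assumed throughout that $0<\mathbb{E}[\chi_i^{(n)}]<\infty$ for every $n$. The GWVE is called regular if for every $\epsilon>0$ there is a finite constant $c_\epsilon$ such that for all $n\geq1$, with $\chi^{(n)}\sim q_n$, $$\mathbb{E}\left[(\chi^{(n)})^2\mathbf{1}_{\{\chi^{(n)}>c_\epsilon(1+\mathbb{E}[\chi^{(n)}])\}}\right]\leq\epsilon\,\mathbb{E}\left[(\chi^{(n)})^2\mathbf{1}_{\{\chi^{(n)}>2\}}\right]<\infty.$$ Let $f_n(s)=\sum_{k\ge0}s^kq_n[k]$, $0\le s\le 1$, be the generating function of $q_n$ (so $f_n'(1),f_n''(1),f_n'''(1)$ are its first, second and third factorial moments). Set $\mu_0:=1$ and, for $n\geq1$, $$\mu_n:=f_1'(1)\cdots f_n'(1),\qquad \nu_n:=\frac{f_n''(1)}{f_n'(1)^2},\qquad \rho_{0,n}:=\sum_{k=0}^{n-1}\frac{\nu_{k+1}}{\mu_k}.$$ $\{X\mid Z_n>0\}$ denotes the conditional law of $X$ given $\{Z_n>0\}$. The Wasserstein distance between probability measures $\mu,\nu$ on $\mathbb{R}$ is $d_W(\mu,\nu)=\sup_{f\in\mathcal{F}}\left|\int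 f\,d\mu-\int f\,d\nu\right|$, where $\mathcal{F}$ is the set of Lipschitz functions $f:\mathbb{R}\to\mathbb{R}$ with $\|f'\|\leq1$; for random variables it means the distance of their laws.
   Formalization: With signed logarithms the bound can be negative for all large n, so it fails as printed; here each log weight in s_n is replaced by its positive part, and the bound is claimed for those n≥3 with log(μ_n ρ_{0,n})+log(f_n'(1))>0 (all but finitely many n). *)

theory Defs
  imports "HOL-Probability.Probability"
begin

section \<open>Generating functions of offspring laws\<close>

text \<open>
  The derivative of order \<open>j\<close> of the generating function \<open>f(s) = (\<Sum>k. s ^ k * pmf p k)\<close> on \<open>[0, 1]\<close>,
  as a term-by-term differentiated power series. It takes values in \<open>[0, \<infinity>]\<close> because the series
  may diverge at \<open>s = 1\<close>, where its value is the factorial moment of order \<open>j\<close>. The subtraction in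
  \<open>k - i\<close> is truncated; the product is nevertheless the falling factorial, since for \<open>k < j\<close> it
  contains the factor \<open>k - k = 0\<close>.
\<close>

definition pgf_deriv :: "nat \<Rightarrow> nat pmf \<Rightarrow> real \<Rightarrow> ennreal" where
  "pgf_deriv j p s = (\<Sum>k. ennreal (real (\<Prod>i<j. k - i) * s ^ (k - j) * pmf p k))"

lemma pgf_deriv_at_1:
  "pgf_deriv j p 1 = (\<integral>\<^sup>+ k. ennreal (real (\<Prod>i<j. k - i)) \<partial>measure_pmf p)"
proof -
  have "(\<integral>\<^sup>+ k. ennreal (real (\<Prod>i<j. k - i)) \<partial>measure_pmf p)
      = (\<integral>\<^sup>+ k. ennreal (pmf p k) * ennreal (real (\<Prod>i<j. k - i)) \<partial>count_space UNIV)"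
    by (rule nn_integral_measure_pmf)
  also have "\<dots> = (\<Sum>k. ennreal (pmf p k) * ennreal (real (\<Prod>i<j. k - i)))"
    by (rule nn_integral_count_space_nat)
  finally show ?thesis
    unfolding pgf_deriv_def
    by (simp add: ennreal_mult prod_nonneg mult.commute)
qed

lemma diffs_funpow:
  fixes u :: "nat \<Rightarrow> real"
  shows "(diffs ^^ j) u m = real (\<Prod>i<j. (m + j) - i) * u (m + j)"
proof (induction j arbitrary: m)
  case (Suc j)
  have "(\<Prod>i<Suc j. (m + Suc j) - i) = Suc m * (\<Prod>i<j. (Suc m + j) - i)"
    by (simp add: mult.commute)
  then show ?case
    using Suc.IH[of "Suc m"] by (simp add: diffs_def algebra_simps)
qed simp

lemma summable_diffs_funpow_pmf:
  fixes s :: real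
  assumes "\<bar>s\<bar> < 1"
  shows "summable (\<lambda>m. (diffs ^^ j) (pmf p) m * s ^ m)"
  using assms
proof (induction j arbitrary: s)
  case 0
  have "summable (\<lambda>m. pmf p m * s ^ m)"
  proof (rule summable_comparison_test')
    show "summable (\<lambda>m. \<bar>s\<bar> ^ m)"
      using 0 by (simp add: summable_geometric)
    show "norm (pmf p m * s ^ m) \<le> \<bar>s\<bar> ^ m" if "0 \<le> m" for m
      by (simp add: abs_mult power_abs mult_left_le_one_le pmf_le_1)
  qed
  then show ?case by simp
next
  case (Suc j)
  have "summable (\<lambda>m. diffs ((diffs ^^ j) (pmf p)) m * s ^ m)"
    using Suc by (intro termdiff_converges[where K = 1]) auto
  then show ?case by simp
qed

lemma pgf_deriv_eq_suminf:
  assumes "0 \<le> s" "s < 1"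
  shows "enn2real (pgf_deriv j p s) = (\<Sum>m. (diffs ^^ j) (pmf p) m * s ^ m)"
proof -
  define t where "t k = real (\<Prod>i<j. k - i) * s ^ (k - j) * pmf p k" for k
  have t_nonneg: "t k \<ge> 0" for k
    using assms by (simp add: t_def prod_nonneg)
  have t_shift: "t (m + j) = (diffs ^^ j) (pmf p) m * s ^ m" for m
    by (simp add: t_def diffs_funpow)
  have t_zero: "t k = 0" if "k < j" for k
  proof -
    have "(\<Prod>i<j. k - i) = 0"
      using that by (intro prod_zero) auto
    then show ?thesis by (simp add: t_def)
  qed
  have summ: "summable t"
    using summable_diffs_funpow_pmf[of s j p] assms
    by (subst summable_iff_shift[of t j, symmetric]) (simp add: t_shift)
  have "pgf_deriv j p s = (\<Sum>k. ennreal (t k))"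
    by (simp add: pgf_deriv_def t_def)
  also have "\<dots> = ennreal (suminf t)"
    using t_nonneg summ by (intro suminf_ennreal2) auto
  finally have "enn2real (pgf_deriv j p s) = suminf t"
    using suminf_nonneg[OF summ] t_nonneg by simp
  also have "\<dots> = (\<Sum>m. t (m + j))"
    using suminf_split_initial_segment[OF summ, of j] t_zero by simp
  finally show ?thesis by (simp add: t_shift)
qed

lemma has_real_derivative_pgf_deriv:
  assumes "0 < s" "s < 1"
  shows "((\<lambda>s. enn2real (pgf_deriv j p s)) has_real_derivative
    enn2real (pgf_deriv (Suc j) p s)) (at s)"
proof -
  let ?u = "(diffs ^^ j) (pmf p)"
  have "((\<lambda>s. \<Sum>m. ?u m * s ^ m) has_real_derivative (\<Sum>m. diffs ?u m * s ^ m)) (at s)"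
    using assms summable_diffs_funpow_pmf[of _ j p]
    by (intro termdiffs_strong'[where K = 1]) auto
  then have "((\<lambda>s. \<Sum>m. ?u m * s ^ m) has_real_derivative enn2real (pgf_deriv (Suc j) p s)) (at s)"
    using assms by (simp add: pgf_deriv_eq_suminf)
  moreover have "\<forall>\<^sub>F x in nhds s. enn2real (pgf_deriv j p x) = (\<Sum>m. ?u m * x ^ m)"
    using assms pgf_deriv_eq_suminf
    by (intro eventually_nhds_in_open[of "{0<..<1}", THEN eventually_mono]) auto
  ultimately show ?thesis
    by (subst DERIV_cong_ev[OF refl _ refl])
qed


section \<open>The varying environment\<close>

text \<open>
  An environment is a sequence \<open>q\<close> of offspring laws of which only the entries \<open>q n\<close> with
  \<open>n \<ge> 1\<close> are used.
\<close>

definition f1 :: "(nat \<Rightarrow> nat pmf) \<Rightarrow> nat \<Rightarrow> real" where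
  "f1 q n = enn2real (pgf_deriv 1 (q n) 1)"

definition f2 :: "(nat \<Rightarrow> nat pmf) \<Rightarrow> nat \<Rightarrow> real" where
  "f2 q n = enn2real (pgf_deriv 2 (q n) 1)"

definition mu :: "(nat \<Rightarrow> nat pmf) \<Rightarrow> nat \<Rightarrow> real" where
  "mu q n = (\<Prod>k = 1..n. f1 q k)"

definition nu :: "(nat \<Rightarrow> nat pmf) \<Rightarrow> nat \<Rightarrow> real" where
  "nu q n = f2 q n / (f1 q n)\<^sup>2"

definition rho :: "(nat \<Rightarrow> nat pmf) \<Rightarrow> nat \<Rightarrow> real" where
  "rho q n = (\<Sum>k<n. nu q (k + 1) / mu q k)"

definition regular :: "(nat \<Rightarrow> nat pmf) \<Rightarrow> bool" where
  "regular q \<longleftrightarrow> (\<forall>\<epsilon>>0. \<exists>c::real. \<forall>n\<ge>1.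
     (\<integral>\<^sup>+ k. ennreal ((real k)\<^sup>2) *
        indicator {k. real k > c * (1 + measure_pmf.expectation (q n) real)} k \<partial>measure_pmf (q n))
       \<le> ennreal \<epsilon> * (\<integral>\<^sup>+ k. ennreal ((real k)\<^sup>2) * indicator {k. k > 2} k \<partial>measure_pmf (q n))
     \<and> ennreal \<epsilon> * (\<integral>\<^sup>+ k. ennreal ((real k)\<^sup>2) * indicator {k. k > 2} k \<partial>measure_pmf (q n)) < \<infinity>)"

definition critical :: "(nat \<Rightarrow> nat pmf) \<Rightarrow> bool" where
  "critical q \<longleftrightarrow> regular q \<and>
     filterlim (rho q) at_top sequentially \<and>
     filterlim (\<lambda>n. mu q n * rho q n) at_top sequentially"

definition sup_mean :: "(nat \<Rightarrow> nat pmf) \<Rightarrow> nat \<Rightarrow> real" where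
  "sup_mean q n = (SUP k\<in>{1..n}. f1 q k)"

definition log_term :: "(nat \<Rightarrow> nat pmf) \<Rightarrow> nat \<Rightarrow> real" where
  "log_term q n = ln (rho q n * mu q n) + ln (f1 q n)"

text \<open>
  The logarithmic weights enter through their positive parts. Only finitely many of them can be
  negative in the setting of the theorem, because \<open>log_term q n \<longlonglongrightarrow> \<infinity>\<close> there, but with the signed
  weights these few summands can keep \<open>s_n\<close>, and the whole error bound built from it, negative for
  all large \<open>n\<close>: take \<open>f_1'' = f_2''\<close> very small, \<open>f_1' = f_2' = 1/2\<close>, and then \<open>f_k'' = 1/2\<close> and
  \<open>f_k' = sqrt (k / (k - 1))\<close> for \<open>k \<ge> 3\<close>.
\<close>

definition s_seq :: "(nat \<Rightarrow> nat pmf) \<Rightarrow> nat \<Rightarrow> real" where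
  "s_seq q n = (\<Sum>k = 2..n - 1. max 0 (log_term q k) * \<bar>1 / mu q (k - 2) - 1 / mu q k\<bar>)"


section \<open>The branching process\<close>

locale gwve = prob_space M for M :: "'w measure" +
  fixes q :: "nat \<Rightarrow> nat pmf"
    and \<xi> :: "nat \<Rightarrow> nat \<Rightarrow> 'w \<Rightarrow> nat"  \<comment> \<open>\<open>\<xi> i n\<close>: offspring of individual \<open>i\<close> of generation \<open>n - 1\<close>\<close>
  assumes offspring_indep:
      "indep_vars (\<lambda>_. count_space UNIV) (\<lambda>(i, n). \<xi> i n) ({1..} \<times> {1..})"
    and offspring_law:
      "\<And>i n. i \<ge> 1 \<Longrightarrow> n \<ge> 1 \<Longrightarrow> distr M (count_space UNIV) (\<xi> i n) = measure_pmf (q n)"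
    and offspring_mean_finite: "\<And>n. n \<ge> 1 \<Longrightarrow> integrable (measure_pmf (q n)) real"
    and offspring_mean_pos: "\<And>n. n \<ge> 1 \<Longrightarrow> 0 < measure_pmf.expectation (q n) real"

primrec gw_process :: "(nat \<Rightarrow> nat \<Rightarrow> 'w \<Rightarrow> nat) \<Rightarrow> nat \<Rightarrow> 'w \<Rightarrow> nat" where
  "gw_process \<xi> 0 \<omega> = 1"
| "gw_process \<xi> (Suc n) \<omega> = (\<Sum>i = 1..gw_process \<xi> n \<omega>. \<xi> i (Suc n) \<omega>)"

definition cond_survival :: "'w measure \<Rightarrow> (nat \<Rightarrow> nat \<Rightarrow> 'w \<Rightarrow> nat) \<Rightarrow> nat \<Rightarrow> 'w measure" where
  "cond_survival M \<xi> n = uniform_measure M {\<omega> \<in> space M. gw_process \<xi> n \<omega> > 0}"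

definition cond_mean :: "'w measure \<Rightarrow> (nat \<Rightarrow> nat \<Rightarrow> 'w \<Rightarrow> nat) \<Rightarrow> nat \<Rightarrow> real" where
  "cond_mean M \<xi> n = (\<integral>\<omega>. real (gw_process \<xi> n \<omega>) \<partial>cond_survival M \<xi> n)"

definition yaglom_law :: "'w measure \<Rightarrow> (nat \<Rightarrow> nat \<Rightarrow> 'w \<Rightarrow> nat) \<Rightarrow> nat \<Rightarrow> real measure" where
  "yaglom_law M \<xi> n =
     distr (cond_survival M \<xi> n) borel (\<lambda>\<omega>. real (gw_process \<xi> n \<omega>) / cond_mean M \<xi> n)"


section \<open>Wasserstein distance\<close>

text \<open>
  Meaningful for laws with finite first moment, for which all the integrals below exist. The
  supremum is taken in the extended reals, so it is a genuine supremum without a proof of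
  boundedness.
\<close>

definition wasserstein :: "real measure \<Rightarrow> real measure \<Rightarrow> ereal" where
  "wasserstein N N' =
     (SUP f\<in>{f. 1-lipschitz_on UNIV f}. ereal \<bar>(\<integral>x. f x \<partial>N) - (\<integral>x. f x \<partial>N')\<bar>)"

abbreviation std_exponential :: "real measure" where
  "std_exponential \<equiv> density lborel (exponential_density 1)"

end

theory Submission
  imports Defs
begin


text \<open>
  Let \<open>p_k\<close> be the probability that one individual of generation \<open>k\<close> has descendants in
  generation \<open>n\<close>, and \<open>Q_k\<close> the law of their number given that there are any. Then \<open>Q_{k-1}\<close> is a
  sum of \<open>N_k\<close> independent copies of \<open>Q_k\<close>, where \<open>N_k\<close> is the number of surviving children given
  that there is one. The Wasserstein distance of a law to the exponential law is controlled, through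
  Stein's method, by its distance to its equilibrium law. The equilibrium law of a random sum consists
  of one equilibrium summand and an independent random sum of ordinary ones, so the distance to
  equilibrium of \<open>Q_{k-1}\<close> exceeds that of \<open>Q_k\<close> by at most the mean of \<open>Q_k\<close> times the distance to
  equilibrium of \<open>N_k\<close>. As \<open>N_k\<close> is a thinning with small success probability \<open>p_k\<close>, three factorial
  moments show that the latter is of order \<open>p_k\<^sup>2\<close>.

  Summing over the generations leaves \<open>\<Sum>k. (\<rho>_k - \<rho>_{k-1}) p_k\<close>, where \<open>p_k\<close> is of the order of
  \<open>(1 / \<mu>_k) / D_k\<close> with \<open>D_k = 1 / \<mu>_n + \<rho>_n - \<rho>_k\<close>. The ratio \<open>(\<rho>_k - \<rho>_{k-1}) / D_k\<close> is bounded by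
  the increment \<open>ln (D_{k-1} / D_k)\<close>, and a summation by parts with step two turns
  \<open>\<Sum>k. (1 / \<mu>_k) ln (D_{k-1} / D_k)\<close> into \<open>s_n\<close> and the boundary term. The finitely many indices with a
  small logarithmic weight contribute a constant, which the claimed bound dominates because its
  variation terms telescope down to a fixed index.
\<close>

section \<open>Compound laws\<close>

primrec iid_sum :: "nat pmf \<Rightarrow> nat \<Rightarrow> nat pmf" where
  "iid_sum P 0 = return_pmf 0"
| "iid_sum P (Suc j) = bind_pmf (iid_sum P j) (\<lambda>x. map_pmf ((+) x) P)"

text \<open>In terms of generating functions this is composition, that of \<open>R\<close> applied
  to that of \<open>P\<close>; hence the associativity and the two-sided unit
  \<open>return_pmf 1\<close>.\<close>

definition compound :: "nat pmf \<Rightarrow> nat pmf \<Rightarrow> nat pmf" where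
  "compound R P = bind_pmf R (iid_sum P)"

lemma iid_sum_add:
  "iid_sum P (i + j) = bind_pmf (iid_sum P i) (\<lambda>x. map_pmf ((+) x) (iid_sum P j))"
proof (induction j)
  case (Suc j)
  then show ?case
    by (simp add: map_pmf_def bind_assoc_pmf bind_return_pmf add.assoc)
qed (simp add: map_pmf_def bind_return_pmf bind_return_pmf')

lemma map_pmf_add_0 [simp]: "map_pmf ((+) (0::nat)) P = P"
  by (simp add: map_pmf_def bind_return_pmf')

lemma iid_sum_1 [simp]: "iid_sum P (Suc 0) = P"
  by (simp add: bind_return_pmf)

lemma iid_sum_compound: "iid_sum (compound R P) j = compound (iid_sum R j) P"
proof (induction j)
  case (Suc j)
  have "iid_sum (compound R P) (Suc j) =
     bind_pmf (iid_sum R j) (\<lambda>a. bind_pmf (iid_sum P a) (\<lambda>x. bind_pmf R (\<lambda>i. map_pmf ((+) x) (iid_sum P i))))"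
    using Suc by (simp add: compound_def bind_assoc_pmf map_bind_pmf)
  \<comment> \<open>The number of further summands is drawn independently of the sum so far, so the
    two draws commute and the sums of copies of \<open>P\<close> merge.\<close>
  also have "\<dots> = bind_pmf (iid_sum R j) (\<lambda>a. bind_pmf R (\<lambda>i. iid_sum P (a + i)))"
    by (subst bind_commute_pmf) (simp add: iid_sum_add)
  also have "\<dots> = compound (iid_sum R (Suc j)) P"
    by (simp add: compound_def bind_assoc_pmf bind_map_pmf)
  finally show ?case .
qed (simp add: compound_def bind_return_pmf)

lemma compound_assoc: "compound (compound R P) Q = compound R (compound P Q)"
proof -
  have "iid_sum (compound P Q) = (\<lambda>i. bind_pmf (iid_sum P i) (iid_sum Q))"
    by (rule ext) (simp add: iid_sum_compound, simp add: compound_def)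
  then show ?thesis
    by (simp add: compound_def[of R] compound_def[of _ Q] bind_assoc_pmf)
qed

lemma iid_sum_return_1: "iid_sum (return_pmf (Suc 0)) j = return_pmf j"
  by (induction j) (simp_all add: bind_return_pmf)

lemma compound_return_1 [simp]:
  "compound P (return_pmf (Suc 0)) = P" "compound (return_pmf (Suc 0)) P = P"
  by (simp_all add: compound_def iid_sum_return_1[abs_def] bind_return_pmf bind_return_pmf'
        del: iid_sum.simps)

lemma iid_sum_ge:
  assumes "0 \<notin> set_pmf P" "x \<in> set_pmf (iid_sum P j)"
  shows "j \<le> x"
  using assms(2)
proof (induction j arbitrary: x)
  case (Suc j)
  then obtain y z where "y \<in> set_pmf (iid_sum P j)" "z \<in> set_pmf P" "x = y + z"
    by auto
  with Suc.IH[of y] assms(1) show ?case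
    by (cases z) auto
qed auto

lemma compound_pos:
  assumes "0 \<notin> set_pmf R" "0 \<notin> set_pmf P"
  shows "0 \<notin> set_pmf (compound R P)"
  using assms iid_sum_ge[OF assms(2)] by (auto simp: compound_def) 

section \<open>Bernoulli laws: splitting off extinction, and thinning\<close>

definition bern :: "real \<Rightarrow> nat pmf" where
  "bern p = map_pmf of_bool (bernoulli_pmf p)"

lemma compound_bern:
  assumes "0 \<le> p" "p \<le> 1"
  shows "pmf (compound (bern p) P) i = p * pmf P i + (1 - p) * indicator {0} i"
  using assms by (simp add: compound_def bern_def bind_map_pmf pmf_bind indicator_def algebra_simps)

lemma measure_pmf_greaterThan_0: "measure (measure_pmf P) {0<..} = 1 - pmf P (0 :: nat)"
proof -
  have "{0<..} = UNIV - {0::nat}" by auto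
  then show ?thesis
    by (simp add: measure_pmf.prob_compl[of "{0::nat}", simplified] measure_pmf_single)
qed

lemma measure_compound_bern:
  assumes "0 \<le> p" "p \<le> 1" "0 \<notin> set_pmf P"
  shows "measure (compound (bern p) P) {0<..} = p"
  using assms by (simp add: measure_pmf_greaterThan_0 compound_bern pmf_eq_0_set_pmf)

lemma set_cond_pos: 
  assumes "measure (measure_pmf P) {0<..} > 0"
  shows "set_pmf P \<inter> {0::nat<..} \<noteq> {}"
  using assms by (metis measure_pmf_zero_iff less_irrefl)

lemma cond_compound_bern:
  assumes "0 < p" "p \<le> 1" "0 \<notin> set_pmf P"
  shows "cond_pmf (compound (bern p) P) {0<..} = P"
proof (rule pmf_eqI)
  fix i
  have m: "measure (compound (bern p) P) {0<..} = p"
    using assms by (intro measure_compound_bern) auto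
  have "set_pmf (compound (bern p) P) \<inter> {0<..} \<noteq> {}"
    by (rule set_cond_pos) (use m assms in simp)
  then show "pmf (cond_pmf (compound (bern p) P) {0<..}) i = pmf P i"
    using assms m by (auto simp: pmf_cond compound_bern pmf_eq_0_set_pmf)
qed

text \<open>A law is determined by its mass off 0 and its conditional law there.
  \<open>cond_compound_bern\<close> is the converse, so a Bernoulli factor in front of a positive
  law can be read off uniquely.\<close>

lemma compound_bern_cond:
  assumes "measure (measure_pmf T) {0<..} > 0"
  shows "T = compound (bern (measure T {0<..})) (cond_pmf T {0<..})"
proof (rule pmf_eqI)
  fix i :: nat
  show "pmf T i = pmf (compound (bern (measure T {0<..})) (cond_pmf T {0<..})) i"
    using assms set_cond_pos[OF assms]
    by (auto simp: compound_bern pmf_cond measure_pmf_greaterThan_0)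
qed

text \<open>Factorial moments of the binomial law, by induction over the trials: a success raises
  \<open>x\<close> to \<open>Suc x\<close>, and the Pascal rule \<open>ff\<close> reduces the
  order.\<close>

lemma nn_integral_iid_sum_bern:
  assumes "0 \<le> p" "p \<le> 1"
  shows "(\<integral>\<^sup>+x. ennreal (real (\<Prod>i<r. x - i)) \<partial>iid_sum (bern p) j) = ennreal (real (\<Prod>i<r. j - i) * p ^ r)"
proof (induction j arbitrary: r)
  case 0
  show ?case by (cases r) auto
next
  case (Suc j)
  have ff: "(\<Prod>i<Suc r. Suc x - i) = (\<Prod>i<Suc r. x - i) + Suc r * (\<Prod>i<r. x - i)" for x r
  proof (cases "r \<le> x")
    case True
    have "(\<Prod>i<Suc r. Suc x - i) = Suc x * (\<Prod>i<r. x - i)"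
      by (subst prod.lessThan_Suc_shift) simp
    moreover have "(\<Prod>i<Suc r. x - i) = (\<Prod>i<r. x - i) * (x - r)"
      by simp
    ultimately show ?thesis using True
      by (simp add: algebra_simps flip: distrib_left)
  next
    case False
    have *: "(\<Prod>i<s. y - i) = 0" if "y < s" for y s :: nat
      using that by (intro prod_zero) auto
    show ?thesis using False by (simp only: *[of "Suc x" "Suc r"] *[of x "Suc r"] *[of x r])
  qed
  show ?case
  proof (cases r)
    case (Suc s)
    have "(\<integral>\<^sup>+x. ennreal (real (\<Prod>i<r. x - i)) \<partial>iid_sum (bern p) (Suc j)) =
       (\<integral>\<^sup>+x. ennreal (real (\<Prod>i<Suc s. Suc x - i)) * ennreal p + ennreal (real (\<Prod>i<Suc s. x - i)) * ennreal (1-p) \<partial>iid_sum (bern p) j)"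
      using assms by (simp add: nn_integral_bind_pmf bern_def map_pmf_comp nn_integral_map_pmf Suc
           del: prod.lessThan_Suc)
    also have "\<dots> = (\<integral>\<^sup>+x. ennreal (real (\<Prod>i<Suc s. x - i)) + ennreal (p * Suc s) * ennreal (real (\<Prod>i<s. x - i)) \<partial>iid_sum (bern p) j)"
    proof (intro nn_integral_cong)
      fix x
      have *: "ennreal (X + Suc s * Y) * ennreal p + ennreal X * ennreal (1 - p) =
          ennreal X + ennreal (p * Suc s) * ennreal Y" if "X \<ge> 0" "Y \<ge> 0" for X Y :: real
      proof -
        have "ennreal (X + Suc s * Y) * ennreal p + ennreal X * ennreal (1 - p) =
            ennreal ((X + Suc s * Y) * p + X * (1 - p))"
          using that assms by (simp add: ennreal_mult' ennreal_plus)
        also have "(X + Suc s * Y) * p + X * (1 - p) = X + (p * Suc s) * Y"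
          by (simp add: algebra_simps)
        also have "ennreal \<dots> = ennreal X + ennreal (p * Suc s) * ennreal Y"
          using that assms by (simp add: ennreal_mult' ennreal_plus)
        finally show ?thesis .
      qed
      show "ennreal (real (\<Prod>i<Suc s. Suc x - i)) * ennreal p + ennreal (real (\<Prod>i<Suc s. x - i)) * ennreal (1-p) =
          ennreal (real (\<Prod>i<Suc s. x - i)) + ennreal (p * Suc s) * ennreal (real (\<Prod>i<s. x - i))"
        unfolding ff of_nat_add of_nat_mult by (rule *) (rule of_nat_0_le_iff)+
    qed
    also have "\<dots> = ennreal (real (\<Prod>i<Suc s. j - i) * p ^ Suc s) + ennreal (p * Suc s) * ennreal (real (\<Prod>i<s. j - i) * p ^ s)"
      by (subst nn_integral_add) (auto simp: nn_integral_cmult Suc.IH simp del: prod.lessThan_Suc of_nat_prod power_Suc)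
    also have "\<dots> = ennreal (real (\<Prod>i<Suc s. j - i) * p ^ Suc s + (p * Suc s) * (real (\<Prod>i<s. j - i) * p ^ s))"
      using assms by (simp add: prod_nonneg flip: ennreal_plus ennreal_mult del: prod.lessThan_Suc of_nat_prod power_Suc)
    also have "(real (\<Prod>i<Suc s. j - i) * p ^ Suc s + (p * Suc s) * (real (\<Prod>i<s. j - i) * p ^ s)) = real (\<Prod>i<r. Suc j - i) * p ^ r"
      unfolding Suc ff by (simp add: algebra_simps del: prod.lessThan_Suc)
    finally show ?thesis .
  qed simp
qed

lemma nn_integral_thinning:
  assumes "0 \<le> p" "p \<le> 1"
  shows "(\<integral>\<^sup>+x. ennreal (real (\<Prod>i<r. x - i)) \<partial>compound q (bern p)) = pgf_deriv r q 1 * ennreal (p ^ r)"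
  using assms unfolding compound_def nn_integral_bind_pmf pgf_deriv_at_1 nn_integral_iid_sum_bern[OF assms]
  by (subst nn_integral_multc[symmetric]) (auto simp: ennreal_mult prod_nonneg intro!: nn_integral_cong)

lemma pmf_thinning_0:
  assumes "0 \<le> p" "p \<le> 1"
  shows "pmf (compound q (bern p)) 0 = (\<integral>j. (1 - p) ^ j \<partial>measure_pmf q)"
proof -
  have "pmf (iid_sum (bern p) j) 0 = (1 - p) ^ j" for j
  proof (induction j)
    case (Suc j)
    have "pmf (iid_sum (bern p) (Suc j)) 0 = (\<integral>x. (1-p) * indicator {0} x \<partial>iid_sum (bern p) j)"
      unfolding iid_sum.simps pmf_bind
    proof (intro integral_cong_AE)
      have "pmf (map_pmf ((+) x) (bern p)) 0 = (1-p) * indicator {0} x" for x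
      proof (cases x)
        case 0
        have "of_bool -` {0::nat} = {False}" by auto
        with 0 assms show ?thesis by (simp add: bern_def pmf_map measure_pmf_single)
      next
        case (Suc y)
        have "(\<lambda>b. Suc (y + of_bool b)) -` {0} = {}" by auto
        with Suc show ?thesis by (simp add: bern_def map_pmf_comp pmf_map)
      qed
      then show "AE x in measure_pmf (iid_sum (bern p) j). pmf (map_pmf ((+) x) (bern p)) 0 = (1-p) * indicator {0} x"
        by simp
    qed auto
    also have "\<dots> = (1-p) * (1-p)^j" using Suc by (simp add: measure_pmf_single)
    finally show ?case by simp
  qed simp
  then show ?thesis by (simp add: compound_def pmf_bind)
qed

text \<open>Wald's identity, in \<open>[0, \<infinity>]\<close> so that integrability can be deduced
  from it.\<close>

lemma nn_integral_compound:
  "(\<integral>\<^sup>+x. ennreal (real x) \<partial>compound R P) = (\<integral>\<^sup>+x. ennreal (real x) \<partial>R) * (\<integral>\<^sup>+x. ennreal (real x) \<partial>P)"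
proof -
  have "(\<integral>\<^sup>+x. ennreal (real x) \<partial>iid_sum P j) = ennreal j * (\<integral>\<^sup>+x. ennreal (real x) \<partial>P)" for j
  proof (induction j)
    case (Suc j)
    then show ?case
      by (simp add: nn_integral_bind_pmf nn_integral_map_pmf nn_integral_add algebra_simps)
  qed simp
  then show ?thesis by (simp add: compound_def nn_integral_bind_pmf nn_integral_multc)
qed


section \<open>Distance to equilibrium\<close>

text \<open>
  The equilibrium law \<open>Q\<^sup>e\<close> of a law \<open>Q\<close> on the positive integers with mean \<open>b\<close> satisfies
  \<open>E G(Q) - G 0 = b * E (G(Q\<^sup>e) - G(Q\<^sup>e - 1))\<close>. So \<open>stein_bound\<close> compares \<open>Q\<close> with \<open>Q\<^sup>e\<close> on functions
  with Lipschitz differences. In \<open>equilibrium_bound\<close> the equilibrium law is eliminated in the same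
  way and the test function itself is Lipschitz.
\<close>

definition stein_bound :: "nat pmf \<Rightarrow> real \<Rightarrow> real \<Rightarrow> bool" where
  "stein_bound Q b \<epsilon> \<longleftrightarrow> (\<forall>G B. (\<forall>t. \<bar>G t\<bar> \<le> B) \<longrightarrow> (\<forall>t. \<bar>G (t + 2) - 2 * G (t + 1) + G t\<bar> \<le> 1) \<longrightarrow>
     \<bar>b * (\<integral>x. G x - G (x - 1) \<partial>measure_pmf Q) - ((\<integral>x. G x \<partial>measure_pmf Q) - G 0)\<bar> \<le> b * \<epsilon>)"

definition equilibrium_bound :: "nat pmf \<Rightarrow> real \<Rightarrow> real \<Rightarrow> bool" where
  "equilibrium_bound N \<nu> W \<longleftrightarrow> (\<forall>A B. (\<forall>j. \<bar>A j\<bar> \<le> B) \<longrightarrow> (\<forall>j\<ge>1. \<bar>A (j + 1) - A j\<bar> \<le> 1) \<longrightarrow>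
     \<bar>\<nu> * (\<integral>n. A n \<partial>measure_pmf N) - (\<integral>n. (\<Sum>j = 1..n. A j) \<partial>measure_pmf N)\<bar> \<le> \<nu> * W)"

lemma integrable_pmf_bounded:
  fixes f :: "nat \<Rightarrow> real"
  assumes "\<And>x. \<bar>f x\<bar> \<le> B"
  shows "integrable (measure_pmf P) f"
  using assms by (intro measure_pmf.integrable_const_bound[where B = B]) auto

lemma expectation_bind_pmf:
  fixes f :: "nat \<Rightarrow> real"
  assumes "\<And>x. \<bar>f x\<bar> \<le> B"
  shows "(\<integral>x. f x \<partial>bind_pmf P K) = (\<integral>y. (\<integral>x. f x \<partial>measure_pmf (K y)) \<partial>measure_pmf P)"
  using assms measurable_measure_pmf[of K] unfolding measure_pmf_bind
  by (intro integral_bind[where K = "count_space UNIV" and B = B and B' = 1])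
     (auto simp: measure_pmf.finite_measure_axioms)

lemma expectation_abs_le:
  fixes f :: "nat \<Rightarrow> real"
  assumes "\<And>x. \<bar>f x\<bar> \<le> B"
  shows "\<bar>\<integral>x. f x \<partial>measure_pmf P\<bar> \<le> B"
proof -
  have "\<bar>\<integral>x. f x \<partial>measure_pmf P\<bar> \<le> (\<integral>x. \<bar>f x\<bar> \<partial>measure_pmf P)"
    by (rule integral_abs_bound)
  also have "\<dots> \<le> (\<integral>x. B \<partial>measure_pmf P)"
    using assms order_trans[OF abs_ge_zero assms[of 0]]
    by (intro integral_mono integrable_pmf_bounded[of _ B]) auto
  finally show ?thesis by simp
qed

lemma expectation_diff_le:
  fixes f g :: "nat \<Rightarrow> real"
  assumes "integrable (measure_pmf P) f" "integrable (measure_pmf P) g" "integrable (measure_pmf P) h"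
    and "\<And>x. x \<in> set_pmf P \<Longrightarrow> \<bar>f x - g x\<bar> \<le> h x"
  shows "\<bar>(\<integral>x. f x \<partial>measure_pmf P) - (\<integral>x. g x \<partial>measure_pmf P)\<bar> \<le> (\<integral>x. h x \<partial>measure_pmf P)"
proof -
  have "\<bar>(\<integral>x. f x \<partial>measure_pmf P) - (\<integral>x. g x \<partial>measure_pmf P)\<bar> = \<bar>\<integral>x. f x - g x \<partial>measure_pmf P\<bar>"
    using assms by simp
  also have "\<dots> \<le> (\<integral>x. \<bar>f x - g x\<bar> \<partial>measure_pmf P)"
    by (rule integral_abs_bound)
  also have "\<dots> \<le> (\<integral>x. h x \<partial>measure_pmf P)"
    using assms by (intro integral_mono_AE integrable_abs integrable_diff) (auto simp: AE_measure_pmf_iff)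
  finally show ?thesis .
qed

lemma integrable_sum_bounded:
  fixes A :: "nat \<Rightarrow> real"
  assumes "integrable (measure_pmf N) real" "\<And>j. \<bar>A j\<bar> \<le> B"
  shows "integrable (measure_pmf N) (\<lambda>n. \<Sum>j = 1..n. A j)"
proof (rule Bochner_Integration.integrable_bound)
  show "integrable (measure_pmf N) (\<lambda>j. B * real j)"
    using assms by simp
  have "\<bar>\<Sum>i = 1..j. A i\<bar> \<le> B * real j" for j
    using sum_norm_bound[of "{1..j}" A B] assms by (simp add: mult.commute)
  then show "AE j in measure_pmf N. norm (\<Sum>i = 1..j. A i) \<le> norm (B * real j)"
    by (intro AE_I2) (smt (verit) real_norm_def)
qed simp

text \<open>The point mass at 1 has the point mass at 1 as its equilibrium law, so the induction
  over the generations starts without error.\<close>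

lemma stein_bound_return_1: "stein_bound (return_pmf 1) 1 0"
  by (simp add: stein_bound_def)

text \<open>Let \<open>A j\<close> and \<open>H j\<close> be the means of the differences of
  \<open>G\<close> and of \<open>G\<close> itself over \<open>j\<close> summands. The bound for
  \<open>Q\<close> compares \<open>b * A (Suc j)\<close> with \<open>H (Suc j) - H j\<close>;
  summation up to \<open>N\<close> telescopes. The bound for \<open>N\<close>, applied to
  \<open>A / b\<close>, then trades the mean of the sum of \<open>A\<close> up to \<open>N\<close>
  for \<open>\<nu>\<close> times the mean of \<open>A\<close>.\<close>

lemma stein_bound_compound:
  assumes Q: "stein_bound Q b \<epsilon>" "0 \<notin> set_pmf Q" "b > 0"
      "integrable (measure_pmf Q) real" "(\<integral>x. real x \<partial>measure_pmf Q) = b"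
    and N: "equilibrium_bound N \<nu> W" "0 \<notin> set_pmf N" "\<nu> > 0"
      "integrable (measure_pmf N) real" "(\<integral>x. real x \<partial>measure_pmf N) = \<nu>"
  shows "stein_bound (compound N Q) (b * \<nu>) (\<epsilon> + b * W)"
  unfolding stein_bound_def
proof (intro allI impI)
  fix G :: "nat \<Rightarrow> real" and B :: real
  assume GB: "\<forall>t. \<bar>G t\<bar> \<le> B" and G2: "\<forall>t. \<bar>G (t + 2) - 2 * G (t + 1) + G t\<bar> \<le> 1"
  define D where "D x = G x - G (x - 1)" for x
  have DB: "\<bar>D x\<bar> \<le> 2 * B" for x
    using GB[rule_format, of x] GB[rule_format, of "x - 1"] unfolding D_def by linarith
  \<comment> \<open>The point 0 is left out because truncation gives \<open>D 0 = 0\<close>. Sums of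
    at least one positive summand avoid it, which is why \<open>equilibrium_bound\<close> constrains
    increments from index 1 only.\<close>
  have D1: "\<bar>D (x + 1) - D x\<bar> \<le> 1" if x: "x \<ge> 1" for x
  proof -
    obtain y where "x = Suc y" using x by (cases x) simp_all
    then show ?thesis using G2[rule_format, of y] by (simp add: D_def algebra_simps)
  qed
  have D2: "\<bar>D (x + y) - D x\<bar> \<le> y" if "x \<ge> 1" for x y
  proof (induction y)
    case (Suc y)
    then show ?case using D1[of "x + y"] that by simp
  qed simp
  define A where "A j = (\<integral>x. D x \<partial>measure_pmf (iid_sum Q j))" for j
  define H where "H j = (\<integral>x. G x \<partial>measure_pmf (iid_sum Q j))" for j
  have AB: "\<bar>A j\<bar> \<le> 2 * B" for j
    unfolding A_def by (intro expectation_abs_le DB)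
  have HB: "\<bar>H j\<bar> \<le> B" for j
    unfolding H_def using GB by (intro expectation_abs_le) auto
  have Suc_int: "(\<integral>x. F x \<partial>measure_pmf (iid_sum Q (Suc j))) =
      (\<integral>x. (\<integral>y. F (x + y) \<partial>measure_pmf Q) \<partial>measure_pmf (iid_sum Q j))"
    if "\<And>x. \<bar>F x\<bar> \<le> C" for F :: "nat \<Rightarrow> real" and C j
    using that by (simp add: expectation_bind_pmf[of F C])
  have A_diff: "\<bar>A (j + 1) - A j\<bar> \<le> b" if "j \<ge> 1" for j
  proof -
    have "\<bar>A (j + 1) - A j\<bar> \<le> (\<integral>x. b \<partial>measure_pmf (iid_sum Q j))"
      unfolding A_def Suc_eq_plus1[symmetric] Suc_int[OF DB]
    proof (rule expectation_diff_le)
      fix x assume "x \<in> set_pmf (iid_sum Q j)"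
      then have "x \<ge> 1" using iid_sum_ge[OF Q(2)] that by fastforce
      have "\<bar>(\<integral>y. D (x + y) \<partial>measure_pmf Q) - (\<integral>y. D x \<partial>measure_pmf Q)\<bar> \<le> (\<integral>y. real y \<partial>measure_pmf Q)"
        by (rule expectation_diff_le) (use D2[OF \<open>x \<ge> 1\<close>] Q(4) DB in \<open>auto intro: integrable_pmf_bounded\<close>)
      then show "\<bar>(\<integral>y. D (x + y) \<partial>measure_pmf Q) - D x\<bar> \<le> b"
        using Q by simp
    qed (auto intro!: integrable_pmf_bounded[of _ "2 * B"] expectation_abs_le DB)
    then show ?thesis by simp
  qed
  \<comment> \<open>Given that the first \<open>j\<close> summands add up to \<open>x\<close>, the
    bound for \<open>Q\<close> is applied to \<open>G\<close> shifted by \<open>x\<close>.\<close>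
  have step: "\<bar>b * A (Suc j) - (H (Suc j) - H j)\<bar> \<le> b * \<epsilon>" for j
  proof -
    have "\<bar>(\<integral>x. b * (\<integral>y. D (x + y) \<partial>measure_pmf Q) \<partial>measure_pmf (iid_sum Q j)) -
        (\<integral>x. (\<integral>y. G (x + y) \<partial>measure_pmf Q) - G x \<partial>measure_pmf (iid_sum Q j))\<bar>
        \<le> (\<integral>x. b * \<epsilon> \<partial>measure_pmf (iid_sum Q j))"
    proof (rule expectation_diff_le)
      fix x
      have "\<bar>b * (\<integral>y. G (x + y) - G (x + (y - 1)) \<partial>measure_pmf Q) - ((\<integral>y. G (x + y) \<partial>measure_pmf Q) - G (x + 0))\<bar>
         \<le> b * \<epsilon>"
        using Q(1)[unfolded stein_bound_def, rule_format, of "\<lambda>y. G (x + y)" B] GB G2[rule_format, of "x + _"]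
        by (simp add: add.assoc)
      moreover have "(\<integral>y. G (x + y) - G (x + (y - 1)) \<partial>measure_pmf Q) = (\<integral>y. D (x + y) \<partial>measure_pmf Q)"
      proof (rule integral_cong_AE)
        have "G (x + y) - G (x + (y - 1)) = D (x + y)" if "y \<in> set_pmf Q" for y
          using that Q(2) by (cases y) (auto simp: D_def)
        then show "AE y in measure_pmf Q. G (x + y) - G (x + (y - 1)) = D (x + y)"
          by (simp add: AE_measure_pmf_iff)
      qed auto
      ultimately show "\<bar>b * (\<integral>y. D (x + y) \<partial>measure_pmf Q) - ((\<integral>y. G (x + y) \<partial>measure_pmf Q) - G x)\<bar>
         \<le> b * \<epsilon>" by simp
    next
      show "integrable (measure_pmf (iid_sum Q j)) (\<lambda>x. b * (\<integral>y. D (x + y) \<partial>measure_pmf Q))"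
        using DB by (intro integrable_mult_right integrable_pmf_bounded[of _ "2 * B"] expectation_abs_le) auto
      show "integrable (measure_pmf (iid_sum Q j)) (\<lambda>x. (\<integral>y. G (x + y) \<partial>measure_pmf Q) - G x)"
        using GB by (intro Bochner_Integration.integrable_diff integrable_pmf_bounded[of _ "B"] expectation_abs_le) auto
    qed auto
    also have "(\<integral>x. (\<integral>y. G (x + y) \<partial>measure_pmf Q) - G x \<partial>measure_pmf (iid_sum Q j)) = H (Suc j) - H j"
      unfolding H_def using GB
      by (subst Bochner_Integration.integral_diff)
        (auto intro!: integrable_pmf_bounded[of _ "B"] expectation_abs_le simp: Suc_int[of G B] simp del: iid_sum.simps)
    finally show ?thesis
      unfolding A_def Suc_int[OF DB] by simp
  qed
  have sum: "\<bar>b * (\<Sum>i = 1..j. A i) - (H j - G 0)\<bar> \<le> b * \<epsilon> * real j" for j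
  proof (induction j)
    case (Suc j)
    then show ?case using step[of j] by (simp add: algebra_simps)
  qed (simp add: H_def)
  have sumA: "integrable (measure_pmf N) (\<lambda>j. \<Sum>i = 1..j. A i)"
    by (rule integrable_sum_bounded[OF N(4) AB])
  have "\<bar>(\<integral>j. b * (\<Sum>i = 1..j. A i) \<partial>measure_pmf N) - (\<integral>j. H j - G 0 \<partial>measure_pmf N)\<bar>
     \<le> (\<integral>j. b * \<epsilon> * real j \<partial>measure_pmf N)"
    using sum sumA N(4)
    by (intro expectation_diff_le Bochner_Integration.integrable_diff integrable_pmf_bounded[OF HB]) auto
  then have 1: "\<bar>b * (\<integral>j. (\<Sum>i = 1..j. A i) \<partial>measure_pmf N) - ((\<integral>j. H j \<partial>measure_pmf N) - G 0)\<bar> \<le> b * \<epsilon> * \<nu>"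
    using N(5) by (simp add: Bochner_Integration.integral_diff[OF integrable_pmf_bounded[OF HB]])
  \<comment> \<open>One more summand moves the argument of \<open>D\<close> by \<open>b\<close> on
    average, so \<open>A / b\<close> has increments of at most 1 from index 1 on.\<close>
  have "\<bar>\<nu> * (\<integral>n. A n / b \<partial>measure_pmf N) - (\<integral>n. (\<Sum>j = 1..n. A j / b) \<partial>measure_pmf N)\<bar> \<le> \<nu> * W"
  proof (intro N(1)[unfolded equilibrium_bound_def, rule_format, of _ "2 * B / b"])
    show "\<bar>A (j + 1) / b - A j / b\<bar> \<le> 1" if "1 \<le> j" for j
      using A_diff[OF that] Q(3) by (simp add: field_simps flip: diff_divide_distrib)
  qed (use AB Q(3) in \<open>auto simp: field_simps\<close>)
  then have "\<bar>(\<nu> * (\<integral>n. A n \<partial>measure_pmf N) - (\<integral>n. (\<Sum>j = 1..n. A j) \<partial>measure_pmf N)) / b\<bar> \<le> \<nu> * W"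
    by (simp add: diff_divide_distrib flip: sum_divide_distrib)
  then have "\<bar>\<nu> * (\<integral>n. A n \<partial>measure_pmf N) - (\<integral>n. (\<Sum>j = 1..n. A j) \<partial>measure_pmf N)\<bar> / b \<le> \<nu> * W"
    using Q(3) by (simp add: abs_divide)
  then have "b * \<bar>\<nu> * (\<integral>n. A n \<partial>measure_pmf N) - (\<integral>n. (\<Sum>j = 1..n. A j) \<partial>measure_pmf N)\<bar> \<le> b * (b * (\<nu> * W))"
    using Q(3) by (intro mult_left_mono) (auto simp: field_simps)
  then have 2: "\<bar>b * \<nu> * (\<integral>n. A n \<partial>measure_pmf N) - b * (\<integral>n. (\<Sum>j = 1..n. A j) \<partial>measure_pmf N)\<bar> \<le> b * (b * (\<nu> * W))"
    using Q(3) by (simp add: abs_mult_pos' right_diff_distrib mult.assoc)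
  have "(\<integral>x. D x \<partial>measure_pmf (compound N Q)) = (\<integral>n. A n \<partial>measure_pmf N)"
    "(\<integral>x. G x \<partial>measure_pmf (compound N Q)) = (\<integral>n. H n \<partial>measure_pmf N)"
    unfolding compound_def A_def H_def using DB GB by (auto intro!: expectation_bind_pmf)
  with 1 2 show "\<bar>b * \<nu> * (\<integral>x. G x - G (x - 1) \<partial>measure_pmf (compound N Q)) - ((\<integral>x. G x \<partial>measure_pmf (compound N Q)) - G 0)\<bar>
      \<le> b * \<nu> * (\<epsilon> + b * W)"
    unfolding D_def[symmetric] by (simp add: algebra_simps)
qed


lemma equilibrium_bound_mono:
  assumes "equilibrium_bound N \<nu> W" "W \<le> W'" "\<nu> \<ge> 0"
  shows "equilibrium_bound N \<nu> W'"
proof -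
  have "\<nu> * W \<le> \<nu> * W'" using assms by (intro mult_left_mono)
  with assms(1) show ?thesis unfolding equilibrium_bound_def by (meson order_trans)
qed

section \<open>Equilibrium bounds from factorial moments\<close>

locale factorial_moments =
  fixes N :: "nat pmf" and e1 n2 :: real
  assumes pos: "0 \<notin> set_pmf N"
    and int1: "integrable (measure_pmf N) real"
    and int2: "integrable (measure_pmf N) (\<lambda>x. real x * (real x - 1))"
    and e1: "(\<integral>x. real x \<partial>measure_pmf N) = e1"
    and n2: "(\<integral>x. real x * (real x - 1) \<partial>measure_pmf N) = n2"
begin

lemma e1_ge_1: "e1 \<ge> 1"
proof -
  have "(\<integral>x. 1 \<partial>measure_pmf N) \<le> (\<integral>x. real x \<partial>measure_pmf N)"
  proof (intro integral_mono_AE)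
    have "1 \<le> real x" if "x \<in> set_pmf N" for x
      using pos that by (cases x) auto
    then show "AE x in measure_pmf N. 1 \<le> real x" by (simp add: AE_measure_pmf_iff)
  qed (use int1 in auto)
  then show ?thesis using e1 by simp
qed

lemma variance_nonneg: "e1 * (e1 - 1) \<le> n2"
proof -
  have "0 \<le> (\<integral>x. (real x - e1)\<^sup>2 \<partial>measure_pmf N)" by simp
  also have "\<dots> = (\<integral>x. real x * (real x - 1) + (1 - 2 * e1) * real x + e1\<^sup>2 \<partial>measure_pmf N)"
    by (intro Bochner_Integration.integral_cong) (auto simp: power2_eq_square algebra_simps)
  also have "\<dots> = n2 + (1 - 2 * e1) * e1 + e1\<^sup>2"
    using int1 int2 e1 n2 by simp
  finally show ?thesis by (simp add: power2_eq_square algebra_simps)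
qed

text \<open>\<open>A\<close> is compared with the constant \<open>A 1\<close>, which cancels because
  both sides give it the weight \<open>e1\<close>. The deviations cost \<open>e1 * (e1 - 1)\<close>
  and \<open>n2 / 2\<close>, and nonnegativity of the variance bounds the former by
  \<open>n2\<close>.\<close>

lemma equilibrium_bound_coarse: "equilibrium_bound N e1 (3 / 2 * n2 / e1)"
  unfolding equilibrium_bound_def
proof (intro allI impI)
  fix A :: "nat \<Rightarrow> real" and B
  assume AB: "\<forall>j. \<bar>A j\<bar> \<le> B" and A1: "\<forall>j\<ge>1. \<bar>A (j + 1) - A j\<bar> \<le> 1"
  have a: "\<bar>A n - A 1\<bar> \<le> real n - 1" if "n \<ge> 1" for n
    using that
  proof (induction n rule: dec_induct)
    case (step n)
    then show ?case using A1[rule_format, of n] by simp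
  qed simp
  have b: "\<bar>(\<Sum>j = 1..n. A j) - real n * A 1\<bar> \<le> real n * (real n - 1) / 2" for n
  proof (induction n)
    case (Suc n)
    have "\<bar>A (Suc n) - A 1\<bar> \<le> real n" using a[of "Suc n"] by simp
    then have "\<bar>(\<Sum>j = 1..n. A j) + A (Suc n) - (real n * A 1 + A 1)\<bar> \<le> real n * (real n - 1) / 2 + real n"
      using Suc by linarith
    then show ?case by (simp add: field_simps)
  qed simp
  have "\<bar>(\<integral>n. A n \<partial>measure_pmf N) - (\<integral>n. A 1 \<partial>measure_pmf N)\<bar> \<le> (\<integral>n. real n - 1 \<partial>measure_pmf N)"
  proof (rule expectation_diff_le)
    show "\<bar>A n - A 1\<bar> \<le> real n - 1" if "n \<in> set_pmf N" for n
      using a[of n] that pos by (cases n) auto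
  qed (use AB int1 in \<open>auto intro: integrable_pmf_bounded\<close>)
  then have "\<bar>(\<integral>n. A n \<partial>measure_pmf N) - A 1\<bar> \<le> e1 - 1"
    using int1 e1 by simp
  then have "\<bar>e1 * (\<integral>n. A n \<partial>measure_pmf N) - e1 * A 1\<bar> \<le> e1 * (e1 - 1)"
    using e1_ge_1 by (simp add: abs_mult flip: right_diff_distrib)
  moreover have "\<bar>(\<integral>n. (\<Sum>j = 1..n. A j) \<partial>measure_pmf N) - (\<integral>n. real n * A 1 \<partial>measure_pmf N)\<bar>
     \<le> (\<integral>n. real n * (real n - 1) / 2 \<partial>measure_pmf N)"
    using b AB int1 int2 by (intro expectation_diff_le integrable_sum_bounded) auto
  then have "\<bar>(\<integral>n. (\<Sum>j = 1..n. A j) \<partial>measure_pmf N) - e1 * A 1\<bar> \<le> n2 / 2"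
    using int1 int2 e1 n2 by simp
  ultimately have "\<bar>e1 * (\<integral>n. A n \<partial>measure_pmf N) - (\<integral>n. (\<Sum>j = 1..n. A j) \<partial>measure_pmf N)\<bar>
     \<le> 3 / 2 * n2"
    using variance_nonneg by linarith
  then show "\<bar>e1 * (\<integral>n. A n \<partial>measure_pmf N) - (\<integral>n. (\<Sum>j = 1..n. A j) \<partial>measure_pmf N)\<bar>
     \<le> e1 * (3 / 2 * n2 / e1)"
    using e1_ge_1 by simp
qed

text \<open>\<open>A\<close> is compared with the affine function through its values at 1 and 2. The
  remainder vanishes at 1 and 2, so the third moment pays for it. The slope is multiplied by
  \<open>e1 * (e1 - 1) - n2 / 2\<close>, which is small by Bonferroni. For thinned laws this gains
  one order over the coarse bound.\<close>

lemma equilibrium_bound_fine: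
  assumes int3: "integrable (measure_pmf N) (\<lambda>x. real x * (real x - 1) * (real x - 2))"
    and n3: "(\<integral>x. real x * (real x - 1) * (real x - 2) \<partial>measure_pmf N) = n3"
  shows "equilibrium_bound N e1 (n3 + n2\<^sup>2 / e1)"
  unfolding equilibrium_bound_def
proof (intro allI impI)
  fix A :: "nat \<Rightarrow> real" and B
  assume AB: "\<forall>j. \<bar>A j\<bar> \<le> B" and A1: "\<forall>j\<ge>1. \<bar>A (j + 1) - A j\<bar> \<le> 1"
  define \<alpha> where "\<alpha> = A 2 - A 1"
  have \<alpha>: "\<bar>\<alpha>\<bar> \<le> 1" using A1[rule_format, of 1] by (simp add: \<alpha>_def numeral_2_eq_2)
  \<comment> \<open>From 2 on the increments of \<open>A\<close> and of the affine function differ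
    by at most \<open>1 + \<bar>\<alpha>\<bar>\<close>, hence by at most 2.\<close>
  have a0: "\<bar>A n - (A 1 + \<alpha> * (real n - 1))\<bar> \<le> 2 * (real n - 2)" if "n \<ge> 2" for n
    using that
  proof (induction n rule: dec_induct)
    case (step n)
    have "\<bar>A (Suc n) - (A 1 + \<alpha> * (real (Suc n) - 1))\<bar> \<le>
        \<bar>A n - (A 1 + \<alpha> * (real n - 1))\<bar> + \<bar>A (n + 1) - A n\<bar> + \<bar>\<alpha>\<bar>"
      by (simp add: algebra_simps)
    with step A1[rule_format, of n] \<alpha> show ?case by simp
  qed (simp add: \<alpha>_def)
  \<comment> \<open>The open interval between 2 and 3 is omitted because the inequality fails there;
    integers never meet it.\<close>
  have c: "x - 2 \<le> x * (x - 1) * (x - 2) / 6" if "x \<in> {2} \<union> {3..}" for x :: real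
  proof (cases "x = 2")
    case False
    then have "x \<ge> 3" using that by auto
    then have "6 \<le> x * (x - 1)" using mult_mono[of 3 x 2 "x - 1"] by simp
    then have "6 * (x - 2) \<le> x * (x - 1) * (x - 2)"
      using \<open>x \<ge> 3\<close> by (intro mult_right_mono) auto
    then show ?thesis by simp
  qed simp
  have c': "real n - 2 \<le> real n * (real n - 1) * (real n - 2) / 6" if n: "n \<ge> 1" for n :: nat
  proof -
    consider "n = 1" | "n = 2" | "n \<ge> 3" using n by linarith
    then show ?thesis using c[of "real n"] by cases auto
  qed
  have a: "\<bar>A n - (A 1 + \<alpha> * (real n - 1))\<bar> \<le> real n * (real n - 1) * (real n - 2) / 3" if "n \<ge> 1" for n
  proof (cases "n = 1")
    case False
    then have "n \<ge> 2" using that by simp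
    have *: "X \<le> 2 * Y \<Longrightarrow> Y \<le> Z / 6 \<Longrightarrow> X \<le> Z / 3" for X Y Z :: real by simp
    show ?thesis by (rule *[OF a0[OF \<open>n \<ge> 2\<close>] c'[OF that]])
  qed simp
  have b0: "\<bar>(\<Sum>j = 1..n. A j) - (real n * A 1 + \<alpha> * (real n * (real n - 1) / 2))\<bar> \<le> (real n - 1) * (real n - 2)"
    if "n \<ge> 1" for n
    using that
  proof (induction n rule: dec_induct)
    case (step n)
    have "\<bar>A (Suc n) - (A 1 + \<alpha> * (real (Suc n) - 1))\<bar> \<le> 2 * (real (Suc n) - 2)"
      using a0[of "Suc n"] step by simp
    then have "\<bar>(\<Sum>j = 1..n. A j) + A (Suc n) - ((real n * A 1 + \<alpha> * (real n * (real n - 1) / 2)) + (A 1 + \<alpha> * (real (Suc n) - 1)))\<bar>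
       \<le> (real n - 1) * (real n - 2) + 2 * (real (Suc n) - 2)"
      using step by linarith
    then show ?case by (simp add: field_simps)
  qed simp
  have b: "\<bar>(\<Sum>j = 1..n. A j) - (real n * A 1 + \<alpha> * (real n * (real n - 1) / 2))\<bar> \<le>
     real n * (real n - 1) * (real n - 2) / 3" if n: "n \<ge> 1" for n
  proof -
    have "(real n - 1) * (real n - 2) \<le> real n * (real n - 1) * (real n - 2) / 3"
    proof -
      consider "n = 1" | "n = 2" | "n \<ge> 3" using n by linarith
      then show ?thesis
      proof cases
        case 3
        then have "3 * ((real n - 1) * (real n - 2)) \<le> real n * ((real n - 1) * (real n - 2))"
          by (intro mult_right_mono) auto
        then show ?thesis by (simp only: mult.assoc)
      qed auto
    qed
    with b0[OF n] show ?thesis by linarith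
  qed
  have N1: "n \<ge> 1" if "n \<in> set_pmf N" for n
    using pos that by (cases n) auto
  have "\<bar>(\<integral>n. A n \<partial>measure_pmf N) - (\<integral>n. A 1 + \<alpha> * (real n - 1) \<partial>measure_pmf N)\<bar> \<le>
     (\<integral>n. real n * (real n - 1) * (real n - 2) / 3 \<partial>measure_pmf N)"
    by (rule expectation_diff_le) (use AB int1 int3 a N1 in \<open>auto intro: integrable_pmf_bounded\<close>)
  then have A: "\<bar>(\<integral>n. A n \<partial>measure_pmf N) - (A 1 + \<alpha> * (e1 - 1))\<bar> \<le> n3 / 3"
    using int1 int3 e1 n3 by simp
  have "\<bar>(\<integral>n. (\<Sum>j = 1..n. A j) \<partial>measure_pmf N) - (\<integral>n. real n * A 1 + \<alpha> * (real n * (real n - 1) / 2) \<partial>measure_pmf N)\<bar>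
     \<le> (\<integral>n. real n * (real n - 1) * (real n - 2) / 3 \<partial>measure_pmf N)"
    by (rule expectation_diff_le) (use b N1 integrable_sum_bounded[OF int1 AB[rule_format]] int1 int2 int3 in auto)
  then have S: "\<bar>(\<integral>n. (\<Sum>j = 1..n. A j) \<partial>measure_pmf N) - (e1 * A 1 + \<alpha> * (n2 / 2))\<bar> \<le> n3 / 3"
    using int1 int2 int3 e1 n2 n3 by simp
  have n23: "n2 \<ge> 0" "n3 \<ge> 0"
  proof -
    have "AE x in measure_pmf N. 0 \<le> real x * (real x - 1)"
      using N1 by (auto simp: AE_measure_pmf_iff)
    then show "n2 \<ge> 0" unfolding n2[symmetric] by (rule integral_nonneg_AE)
    have "0 \<le> real x * (real x - 1) * (real x - 2)" if "x \<in> set_pmf N" for x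
      using N1[OF that] by (cases "x = 1") auto
    then have "AE x in measure_pmf N. 0 \<le> real x * (real x - 1) * (real x - 2)"
      by (auto simp: AE_measure_pmf_iff)
    then show "n3 \<ge> 0" unfolding n3[symmetric] by (rule integral_nonneg_AE)
  qed
  \<comment> \<open>Bonferroni: on positive integers the indicator of \<open>x > 0\<close> equals 1
    and lies above \<open>x - x * (x - 1) / 2\<close>. Adding the term of third order reverses the
    inequality, which is \<open>lo\<close> below.\<close>
  have up: "e1 - 1 \<le> n2 / 2"
  proof -
    have "(\<integral>x. real x - 1 \<partial>measure_pmf N) \<le> (\<integral>x. real x * (real x - 1) / 2 \<partial>measure_pmf N)"
    proof (intro integral_mono_AE)
      have "real x - 1 \<le> real x * (real x - 1) / 2" if "x \<in> set_pmf N" for x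
        using N1[OF that] mult_right_mono[of 2 "real x" "real x - 1"] by (cases "x = 1") auto
      then show "AE x in measure_pmf N. real x - 1 \<le> real x * (real x - 1) / 2"
        by (simp add: AE_measure_pmf_iff)
    qed (use int1 int2 in auto)
    then show ?thesis using int1 int2 e1 n2 by simp
  qed
  have lo: "n2 / 2 - n3 / 6 \<le> e1 - 1"
  proof -
    have "(\<integral>x. real x * (real x - 1) / 2 - real x * (real x - 1) * (real x - 2) / 6 \<partial>measure_pmf N) \<le>
        (\<integral>x. real x - 1 \<partial>measure_pmf N)"
    proof (intro integral_mono_AE)
      have "real x * (real x - 1) / 2 - real x * (real x - 1) * (real x - 2) / 6 \<le> real x - 1"
        if "x \<in> set_pmf N" for x
      proof -
        have "0 \<le> (real x - 1) * ((real x - 2) * (real x - 3))"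
          using N1[OF that] by (cases "x = 1 \<or> x = 2") auto
        then show ?thesis by (simp add: field_simps)
      qed
      then show "AE x in measure_pmf N. real x * (real x - 1) / 2 - real x * (real x - 1) * (real x - 2) / 6 \<le> real x - 1"
        by (simp add: AE_measure_pmf_iff)
    qed (use int1 int2 int3 in auto)
    then show ?thesis using int1 int2 int3 e1 n2 n3 by simp
  qed
  have A': "\<bar>e1 * (\<integral>n. A n \<partial>measure_pmf N) - (e1 * A 1 + \<alpha> * (e1 * (e1 - 1)))\<bar> \<le> e1 * n3 / 3"
  proof -
    have "\<bar>e1 * (\<integral>n. A n \<partial>measure_pmf N) - (e1 * A 1 + \<alpha> * (e1 * (e1 - 1)))\<bar> =
       e1 * \<bar>(\<integral>n. A n \<partial>measure_pmf N) - (A 1 + \<alpha> * (e1 - 1))\<bar>"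
      using e1_ge_1 by (simp add: abs_mult_pos' algebra_simps)
    also have "\<dots> \<le> e1 * (n3 / 3)" using A e1_ge_1 by (intro mult_left_mono) auto
    finally show ?thesis by simp
  qed
  have "\<bar>\<alpha> * (e1 * (e1 - 1)) - \<alpha> * (n2 / 2)\<bar> \<le> e1 * n3 / 6 + n2\<^sup>2 / 4"
  proof -
    \<comment> \<open>The first part of the split is small by both Bonferroni bounds, the second by
      the upper one.\<close>
    have "\<alpha> * (e1 * (e1 - 1)) - \<alpha> * (n2 / 2) = \<alpha> * (e1 * (e1 - 1 - n2 / 2) + (n2 / 2) * (e1 - 1))"
      by (simp add: field_simps)
    then have "\<bar>\<alpha> * (e1 * (e1 - 1)) - \<alpha> * (n2 / 2)\<bar> = \<bar>\<alpha>\<bar> * \<bar>e1 * (e1 - 1 - n2 / 2) + (n2 / 2) * (e1 - 1)\<bar>"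
      by (simp add: abs_mult)
    also have "\<dots> \<le> \<bar>e1 * (e1 - 1 - n2 / 2) + (n2 / 2) * (e1 - 1)\<bar>"
      using \<alpha> by (intro mult_left_le_one_le) auto
    also have "\<dots> \<le> \<bar>e1 * (e1 - 1 - n2 / 2)\<bar> + \<bar>(n2 / 2) * (e1 - 1)\<bar>"
      by (rule abs_triangle_ineq)
    also have "\<dots> = e1 * \<bar>e1 - 1 - n2 / 2\<bar> + (n2 / 2) * (e1 - 1)"
      using e1_ge_1 n23 by (simp add: abs_mult)
    also have "\<dots> \<le> e1 * (n3 / 6) + (n2 / 2) * (n2 / 2)"
      using e1_ge_1 n23 up lo by (intro add_mono mult_left_mono) auto
    finally show ?thesis by (simp add: power2_eq_square)
  qed
  then have "\<bar>e1 * (\<integral>n. A n \<partial>measure_pmf N) - (\<integral>n. (\<Sum>j = 1..n. A j) \<partial>measure_pmf N)\<bar>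
     \<le> e1 * n3 / 3 + n3 / 3 + (e1 * n3 / 6 + n2\<^sup>2 / 4)"
    using A' S by linarith
  also have "\<dots> \<le> e1 * n3 + n2\<^sup>2"
    using mult_right_mono[OF e1_ge_1 n23(2)] zero_le_power2[of n2] n23(2) by linarith
  finally show "\<bar>e1 * (\<integral>n. A n \<partial>measure_pmf N) - (\<integral>n. (\<Sum>j = 1..n. A j) \<partial>measure_pmf N)\<bar>
     \<le> e1 * (n3 + n2\<^sup>2 / e1)"
    using e1_ge_1 by (simp add: distrib_left)
qed

end


section \<open>Thinned offspring laws\<close>

lemma falling_factorial_simps:
  "real (\<Prod>i<1. (x::nat) - i) = real x"
  "real (\<Prod>i<2. (x::nat) - i) = real x * (real x - 1)"
  "real (\<Prod>i<3. (x::nat) - i) = real x * (real x - 1) * (real x - 2)"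
proof -
  have *: "{..<2::nat} = {0, 1}" "{..<3::nat} = {0, 1, 2}" by auto
  show "real (\<Prod>i<1. (x::nat) - i) = real x" by simp
  show "real (\<Prod>i<2. (x::nat) - i) = real x * (real x - 1)"
    unfolding * by (cases x) (auto simp: algebra_simps)
  consider "x = 0" | "x = 1" | y where "x = y + 2"
    by (metis One_nat_def add_2_eq_Suc' not0_implies_Suc)
  then show "real (\<Prod>i<3. (x::nat) - i) = real x * (real x - 1) * (real x - 2)"
    unfolding * by cases (auto simp: algebra_simps)
qed

lemma integral_falling_factorial:
  assumes "pgf_deriv r q 1 = ennreal F" "F \<ge> 0"
  shows "integrable (measure_pmf q) (\<lambda>x. real (\<Prod>i<r. x - i))"
    "(\<integral>x. real (\<Prod>i<r. x - i) \<partial>measure_pmf q) = F"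
proof -
  have *: "(\<integral>\<^sup>+x. ennreal (real (\<Prod>i<r. x - i)) \<partial>measure_pmf q) = ennreal F"
    using assms by (simp add: pgf_deriv_at_1)
  have AE: "AE x in measure_pmf q. 0 \<le> real (\<Prod>i<r. x - i)" 
    by (rule AE_I2) (rule of_nat_0_le_iff)
  show "integrable (measure_pmf q) (\<lambda>x. real (\<Prod>i<r. x - i))"
    by (rule integrableI_nn_integral_finite[OF _ AE *]) auto
  show "(\<integral>x. real (\<Prod>i<r. x - i) \<partial>measure_pmf q) = F"
    by (rule integral_eq_nn_integral[THEN trans]) (use AE * assms in auto)
qed

text \<open>For positive order the value 0 adds nothing to the factorial moment, so conditioning on
  being positive merely divides by \<open>\<pi>\<close>.\<close>

lemma thinning_cond_moment:
  assumes p: "0 \<le> p" "p \<le> 1" and r: "r > 0" and F: "pgf_deriv r q 1 = ennreal F" "F \<ge> 0"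
    and \<pi>: "\<pi> = measure (compound q (bern p)) {0<..}" "\<pi> > 0"
  shows "pgf_deriv r (cond_pmf (compound q (bern p)) {0<..}) 1 = ennreal (F * p ^ r / \<pi>)"
proof -
  define N where "N = cond_pmf (compound q (bern p)) {0<..}"
  have \<pi>1: "\<pi> \<le> 1" unfolding \<pi>(1) by (rule measure_pmf.prob_le_1)
  have "compound q (bern p) = compound (bern \<pi>) N"
    unfolding N_def \<pi>(1) by (rule compound_bern_cond) (use \<pi> in simp)
  then have "ennreal (F * p ^ r) = (\<integral>\<^sup>+x. ennreal (real (\<Prod>i<r. x - i)) \<partial>compound (bern \<pi>) N)"
    using nn_integral_thinning[OF p, of q r] F p by (simp add: ennreal_mult del: of_nat_prod)
  also have "\<dots> = ennreal \<pi> * (\<integral>\<^sup>+x. ennreal (real (\<Prod>i<r. x - i)) \<partial>measure_pmf N)"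
    using \<pi> \<pi>1 r by (cases r) (simp_all add: compound_def bern_def bind_map_pmf mult.commute prod.lessThan_Suc_shift del: prod.lessThan_Suc)
  finally have *: "ennreal (F * p ^ r) = ennreal \<pi> * pgf_deriv r N 1"
    by (simp add: pgf_deriv_at_1)
  have "ennreal (F * p ^ r / \<pi>) = ennreal (1 / \<pi>) * ennreal (F * p ^ r)"
    using \<pi> by (simp flip: ennreal_mult')
  also have "\<dots> = pgf_deriv r N 1"
    unfolding * using \<pi> by (simp add: mult.assoc[symmetric] flip: ennreal_mult')
  finally show ?thesis by (simp add: N_def)
qed

text \<open>As \<open>c\<close> enters only through an upper bound for \<open>t\<close>,
  \<open>c \<ge> 1\<close> can be arranged by enlarging it.\<close>

locale offspring =
  fixes q :: "nat pmf" and m s t c :: real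
  assumes moment1: "pgf_deriv 1 q 1 = ennreal m"
    and moment2: "pgf_deriv 2 q 1 = ennreal s"
    and moment3: "pgf_deriv 3 q 1 = ennreal t"
    and m_pos: "m > 0" and s_pos: "s > 0" and t_nonneg: "t \<ge> 0" and c_ge_1: "c \<ge> 1"
    and moment3_le: "t \<le> c * s * (1 + m)"
begin

lemma moments:
  shows "integrable (measure_pmf q) real" "(\<integral>x. real x \<partial>measure_pmf q) = m"
    and "integrable (measure_pmf q) (\<lambda>x. real x * (real x - 1))" "(\<integral>x. real x * (real x - 1) \<partial>measure_pmf q) = s"
    and "integrable (measure_pmf q) (\<lambda>x. real x * (real x - 1) * (real x - 2))"
      "(\<integral>x. real x * (real x - 1) * (real x - 2) \<partial>measure_pmf q) = t"
  using integral_falling_factorial[OF moment1] integral_falling_factorial[OF moment2]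
    integral_falling_factorial[OF moment3] m_pos s_pos t_nonneg
  unfolding falling_factorial_simps by auto

lemma integrable_pred: "integrable (measure_pmf q) (\<lambda>x. real (x - 1))"
  by (rule Bochner_Integration.integrable_bound[OF moments(1)]) auto

text \<open>
  The third moment condition keeps the second moment from being carried by rare large families,
  so that it is already controlled by the mean excess over one child.
\<close>

lemma moment2_le_excess: "s \<le> 4 * c * (1 + m) * (\<integral>x. real (x - 1) \<partial>measure_pmf q)"
proof -
  \<comment> \<open>With this \<open>l\<close> the third moment condition reads
    \<open>t \<le> l * s / 2\<close>, so half of \<open>l * s\<close> survives the subtraction of
    \<open>t\<close>.\<close>
  define l where "l = 2 * c * (1 + m)"
  have "l \<ge> 2" using c_ge_1 m_pos mult_mono[of 1 c 1 "1 + m"] by (simp add: l_def mult.assoc)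
  then have l: "l \<ge> 2" "l > 0" by auto
  have "(\<integral>x. l * (real x * (real x - 1)) - real x * (real x - 1) * (real x - 2) \<partial>measure_pmf q)
      \<le> (\<integral>x. l\<^sup>2 * real (x - 1) \<partial>measure_pmf q)"
  proof (intro integral_mono)
    fix x :: nat
    show "l * (real x * (real x - 1)) - real x * (real x - 1) * (real x - 2) \<le> l\<^sup>2 * real (x - 1)"
    proof (cases "x = 0")
      case False
      \<comment> \<open>Completing the square: the maximum \<open>((l + 2) / 2)\<^sup>2\<close> of
        \<open>x * (l + 2 - x)\<close> is at most \<open>l\<^sup>2\<close> because
        \<open>l \<ge> 2\<close>.\<close>
      have "0 \<le> (real x - (l + 2) / 2)\<^sup>2 + (l\<^sup>2 - ((l + 2) / 2)\<^sup>2)"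
        using l by (intro add_nonneg_nonneg) (auto intro: power_mono)
      also have "\<dots> = l\<^sup>2 - real x * (l + 2 - real x)"
        by (simp add: power2_eq_square field_simps)
      finally have "(real x - 1) * (real x * (l + 2 - real x)) \<le> (real x - 1) * l\<^sup>2"
        using False by (intro mult_left_mono) auto
      then show ?thesis using False by (simp add: of_nat_diff algebra_simps)
    qed simp
  qed (use moments integrable_pred in auto)
  then have "l * s - t \<le> l\<^sup>2 * (\<integral>x. real (x - 1) \<partial>measure_pmf q)"
    using moments by simp
  moreover have "t \<le> l * s / 2"
    using moment3_le by (simp add: l_def algebra_simps)
  ultimately have "l * s \<le> l * (2 * l * (\<integral>x. real (x - 1) \<partial>measure_pmf q))"
    by (simp add: power2_eq_square)
  then show ?thesis
    using l by (simp only: mult_le_cancel_left_pos[of l]) (simp add: l_def)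
qed

lemma moment2_le: "s \<le> 4 * c * (1 + m) * m"
proof -
  have "(\<integral>x. real (x - 1) \<partial>measure_pmf q) \<le> (\<integral>x. real x \<partial>measure_pmf q)"
    by (intro integral_mono integrable_pred moments) auto
  then have "4 * c * (1 + m) * (\<integral>x. real (x - 1) \<partial>measure_pmf q) \<le> 4 * c * (1 + m) * m"
    using m_pos c_ge_1 by (intro mult_left_mono) (auto simp: moments)
  with moment2_le_excess show ?thesis by linarith
qed

end

text \<open>In the application, \<open>p\<close> is the chance that a child has descendants in the
  final generation and \<open>\<pi>\<close> that the parent has; \<open>N\<close> counts such
  children given that there is one.\<close>

locale thinned_offspring = offspring +
  fixes p \<pi> :: real
  assumes p: "0 < p" "p \<le> 1"
    and \<pi>_eq: "\<pi> = measure (measure_pmf (compound q (bern p))) {0<..}"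
begin

lemma \<pi>_integral: "\<pi> = 1 - (\<integral>j. (1 - p) ^ j \<partial>measure_pmf q)"
  unfolding \<pi>_eq measure_pmf_greaterThan_0 using p by (simp add: pmf_thinning_0)

lemma integrable_power: "integrable (measure_pmf q) (\<lambda>j. (1 - p) ^ j)"
  using p by (intro integrable_pmf_bounded[of _ 1]) (auto simp: power_le_one)

lemma \<pi>_pos: "\<pi> > 0"
proof -
  have "\<exists>x\<in>set_pmf q. x \<noteq> 0"
  proof (rule ccontr)
    assume "\<not> ?thesis"
    then have "(\<integral>x. real x \<partial>measure_pmf q) = 0"
      by (intro integral_eq_zero_AE) (auto simp: AE_measure_pmf_iff)
    then show False using moments m_pos by simp
  qed
  then obtain x where x: "x \<in> set_pmf q" "x \<noteq> 0" by blast
  have "pmf q x * (1 - (1 - p) ^ x) = (\<integral>j. indicator {x} j * (1 - (1 - p) ^ x) \<partial>measure_pmf q)"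
    by (simp add: measure_pmf_single)
  also have "\<dots> \<le> (\<integral>j. 1 - (1 - p) ^ j \<partial>measure_pmf q)"
  proof (intro integral_mono)
    show "integrable (measure_pmf q) (\<lambda>j. 1 - (1 - p) ^ j)"
      using integrable_power by simp
    show "indicator {x} j * (1 - (1 - p) ^ x) \<le> 1 - (1 - p) ^ j" for j
      using p by (auto simp: indicator_def power_le_one)
  qed (auto intro!: integrable_pmf_bounded[of _ 1] simp: indicator_def)
  also have "\<dots> = \<pi>" using integrable_power by (simp add: \<pi>_integral)
  finally show ?thesis
    using x p power_strict_mono[of "1 - p" 1 x] mult_pos_pos[OF pmf_positive[OF x(1)], of "1 - (1 - p) ^ x"]
    by simp
qed

lemma \<pi>_le_1: "\<pi> \<le> 1"
  unfolding \<pi>_eq by (rule measure_pmf.prob_le_1)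

text \<open>Each child beyond the first lowers the union bound \<open>j * p\<close> by at least
  \<open>p\<^sup>2\<close>. This gain is linear in \<open>j\<close>, so its mean involves just the
  mean excess that controls \<open>s\<close>.\<close>

lemma \<pi>_le: "\<pi> \<le> m * p - p\<^sup>2 * (\<integral>x. real (x - 1) \<partial>measure_pmf q)"
proof -
  have *: "1 - (1 - p) ^ j \<le> real j * p - p\<^sup>2 * real (j - 1)" for j
  proof (induction j)
    case (Suc j)
    show ?case
    proof (cases "j = 0")
      case False
      have "(1 - p) * (1 - real j * p + p\<^sup>2 * real (j - 1)) \<le> (1 - p) * (1 - p) ^ j"
        using Suc p by (intro mult_left_mono) auto
      moreover have "0 \<le> p\<^sup>2 * (real (j - 1) * (1 - p))" using p by simp
      ultimately show ?thesis
        using False by (simp add: of_nat_diff algebra_simps power2_eq_square)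
    qed simp
  qed simp
  have "\<pi> = (\<integral>j. 1 - (1 - p) ^ j \<partial>measure_pmf q)"
    using integrable_power by (simp add: \<pi>_integral)
  also have "\<dots> \<le> (\<integral>j. real j * p - p\<^sup>2 * real (j - 1) \<partial>measure_pmf q)"
    using * integrable_power moments integrable_pred by (intro integral_mono) auto
  also have "\<dots> = m * p - p\<^sup>2 * (\<integral>x. real (x - 1) \<partial>measure_pmf q)"
    using moments integrable_pred by simp
  finally show ?thesis .
qed

text \<open>The gain is divided by \<open>\<pi> * (m * p)\<close>, which is at most
  \<open>(m * p)\<^sup>2\<close>, so \<open>p\<close> disappears. What remains is
  \<open>s / m\<^sup>2\<close>, the normalised second moment, up to a factor; iteration will build
  \<open>rho\<close> from it.\<close>

lemma inverse_survival_growth: "1 / \<pi> - 1 / (m * p) \<ge> s / (4 * c * (1 + m) * m\<^sup>2)"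
proof -
  define e where "e = (\<integral>x. real (x - 1) \<partial>measure_pmf q)"
  have e: "s / (4 * c * (1 + m)) \<le> e"
    using moment2_le_excess c_ge_1 m_pos by (subst pos_divide_le_eq) (auto simp: e_def mult.commute)
  have "0 \<le> e" unfolding e_def by simp
  have "\<pi> \<le> m * p" using \<pi>_le mult_nonneg_nonneg[OF zero_le_power2 \<open>0 \<le> e\<close>, of p]
    unfolding e_def by linarith
  have "s / (4 * c * (1 + m) * m\<^sup>2) = (s / (4 * c * (1 + m))) / m\<^sup>2" by simp
  also have "\<dots> \<le> e / m\<^sup>2" using e by (intro divide_right_mono) auto
  also have "\<dots> = p\<^sup>2 * e / ((m * p) * (m * p))" using p m_pos by (simp add: power2_eq_square)
  also have "\<dots> \<le> p\<^sup>2 * e / (\<pi> * (m * p))"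
    using \<pi>_pos p m_pos \<open>\<pi> \<le> m * p\<close> \<open>0 \<le> e\<close> by (intro divide_left_mono mult_right_mono) auto
  also have "\<dots> \<le> (m * p - \<pi>) / (\<pi> * (m * p))"
    using \<pi>_pos p m_pos \<pi>_le by (intro divide_right_mono) (auto simp: e_def)
  also have "\<dots> = 1 / \<pi> - 1 / (m * p)"
    using \<pi>_pos p m_pos by (simp add: field_simps)
  finally show ?thesis .
qed

abbreviation "N \<equiv> cond_pmf (compound q (bern p)) {0<..}"

lemma N_pos: "0 \<notin> set_pmf N"
  using set_cond_pos[of "compound q (bern p)"] \<pi>_pos by (simp add: \<pi>_eq set_cond_pmf)

lemma N_moments:
  shows "integrable (measure_pmf N) real" "(\<integral>x. real x \<partial>measure_pmf N) = m * p / \<pi>"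
    and "integrable (measure_pmf N) (\<lambda>x. real x * (real x - 1))"
      "(\<integral>x. real x * (real x - 1) \<partial>measure_pmf N) = s * p\<^sup>2 / \<pi>"
    and "integrable (measure_pmf N) (\<lambda>x. real x * (real x - 1) * (real x - 2))"
      "(\<integral>x. real x * (real x - 1) * (real x - 2) \<partial>measure_pmf N) = t * p ^ 3 / \<pi>"
  using integral_falling_factorial[OF thinning_cond_moment[OF _ _ _ moment1 _ \<pi>_eq]]
    integral_falling_factorial[OF thinning_cond_moment[OF _ _ _ moment2 _ \<pi>_eq]]
    integral_falling_factorial[OF thinning_cond_moment[OF _ _ _ moment3 _ \<pi>_eq]]
    p m_pos s_pos t_nonneg \<pi>_pos
  unfolding falling_factorial_simps by auto

sublocale factorial_moments N "m * p / \<pi>" "s * p\<^sup>2 / \<pi>"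
  by unfold_locales (use N_pos N_moments in auto)

text \<open>If \<open>s * p / m\<close> is at most 1, the variance inequality keeps the mean of
  \<open>N\<close> below 2, so \<open>\<pi>\<close> is comparable to \<open>m * p\<close> and the
  fine bound has order \<open>p\<^sup>2\<close>. Otherwise \<open>p\<close> is bounded below, and
  the factor \<open>p\<close> that the coarse bound lacks can be inserted.\<close>

lemma equilibrium_bound_N:
  "equilibrium_bound N (m * p / \<pi>) (10 * c * (1 + m) * s * p\<^sup>2 / m)"
proof (cases "s * p / m \<le> 1")
  case True
  have "m * p / \<pi> - 1 \<le> s * p / m"
  proof -
    have "m * p / \<pi> - 1 \<le> (s * p\<^sup>2 / \<pi>) / (m * p / \<pi>)"
      using variance_nonneg \<pi>_pos m_pos p by (subst pos_le_divide_eq) (auto simp: mult.commute)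
    also have "\<dots> = s * p / m" using \<pi>_pos m_pos p by (simp add: power2_eq_square)
    finally show ?thesis .
  qed
  with True have "m * p / \<pi> \<le> 2" by simp
  then have \<pi>': "1 / \<pi> \<le> 2 / (m * p)" using \<pi>_pos m_pos p by (simp add: field_simps)
  have "t * p ^ 3 / \<pi> + (s * p\<^sup>2 / \<pi>)\<^sup>2 / (m * p / \<pi>) = (t + s\<^sup>2 / m) * p ^ 3 * (1 / \<pi>)"
    using \<pi>_pos m_pos p by (simp add: field_simps power2_eq_square power3_eq_cube)
  also have "\<dots> \<le> (5 * c * s * (1 + m)) * p ^ 3 * (2 / (m * p))"
  proof (intro mult_mono \<pi>')
    have "s * s \<le> s * (4 * c * (1 + m) * m)"
      using s_pos moment2_le by (intro mult_left_mono) auto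
    then have "s\<^sup>2 / m \<le> 4 * c * (1 + m) * s"
      using m_pos by (simp add: power2_eq_square divide_le_eq mult.commute mult.left_commute)
    with moment3_le show "t + s\<^sup>2 / m \<le> 5 * c * s * (1 + m)"
      by (simp add: algebra_simps)
  qed (use p m_pos s_pos c_ge_1 \<pi>_pos in auto)
  also have "\<dots> = 10 * c * (1 + m) * s * p\<^sup>2 / m"
    using p m_pos by (simp add: field_simps power2_eq_square power3_eq_cube)
  finally show ?thesis
    by (rule equilibrium_bound_mono[OF equilibrium_bound_fine[OF N_moments(5,6)]])
      (use \<pi>_pos m_pos p in simp)
next
  case False
  have "s * p / m \<le> 4 * c * (1 + m) * p"
  proof -
    have "s / m \<le> 4 * c * (1 + m)" using moment2_le m_pos by (simp only: pos_divide_le_eq)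
    from mult_right_mono[OF this, of p] p show ?thesis by simp
  qed
  with False have *: "1 \<le> 4 * c * (1 + m) * p" by linarith
  have "3 / 2 * (s * p\<^sup>2 / \<pi>) / (m * p / \<pi>) = 3 / 2 * (s * p / m) * 1"
    using \<pi>_pos m_pos p by (simp add: field_simps power2_eq_square)
  also have "\<dots> \<le> 3 / 2 * (s * p / m) * (4 * c * (1 + m) * p)"
    using * s_pos p m_pos by (intro mult_left_mono) auto
  also have "\<dots> \<le> 5 / 2 * (s * p / m) * (4 * c * (1 + m) * p)"
    using s_pos p m_pos c_ge_1 by (intro mult_right_mono) auto
  also have "\<dots> = 10 * c * (1 + m) * s * p\<^sup>2 / m"
    by (simp add: power2_eq_square)
  finally show ?thesis
    by (rule equilibrium_bound_mono[OF equilibrium_bound_coarse])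
      (use \<pi>_pos m_pos p in simp)
qed

end


section \<open>Stein's equation of the exponential law\<close>

interpretation std_exponential: prob_space std_exponential
  by (rule prob_space_exponential_density) simp

lemma integrable_std_exponential_id: "integrable std_exponential (\<lambda>x. x)"
proof -
  have "distributed std_exponential lborel (\<lambda>x. x) (exponential_density 1)"
    by (auto simp: distributed_def distr_id2 exponential_density_nonneg)
  then show ?thesis
    using std_exponential.erlang_ith_moment_integrable[of 1 "\<lambda>x. x" 0 1] by simp
qed

locale bounded_lipschitz_test =
  fixes h :: "real \<Rightarrow> real" and B :: real
  assumes lip: "1-lipschitz_on UNIV h" and bdd: "\<And>x. \<bar>h x\<bar> \<le> B"
begin

lemma h_diff: "\<bar>h x - h y\<bar> \<le> \<bar>x - y\<bar>"
  using lipschitz_onD[OF lip, of x y] by (simp add: dist_real_def)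

lemma h_cont: "continuous_on UNIV h"
  by (rule lipschitz_on_continuous_on[OF lip])

lemma h_measurable [measurable]: "h \<in> borel_measurable borel"
  by (rule borel_measurable_continuous_onI[OF h_cont])

text \<open>
  For this choice \<open>H' = H - h\<close>, so that \<open>g = H 0 - H\<close> solves Stein's equation
  \<open>g' - g = h - H 0\<close> of the exponential law with \<open>g 0 = 0\<close>.
\<close>

definition H :: "real \<Rightarrow> real" where
  "H x = (\<integral>s. h (x + s) \<partial>std_exponential)"

lemma H_integrable: "integrable std_exponential (\<lambda>s. h (x + s))"
  by (rule std_exponential.integrable_const_bound[where B = B]) (auto simp: bdd)

lemma H_diff: "\<bar>H x - H y\<bar> \<le> \<bar>x - y\<bar>"
proof -
  have "\<bar>H x - H y\<bar> = \<bar>\<integral>s. h (x + s) - h (y + s) \<partial>std_exponential\<bar>"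
    unfolding H_def by (subst Bochner_Integration.integral_diff) (auto intro: H_integrable)
  also have "\<dots> \<le> (\<integral>s. \<bar>h (x + s) - h (y + s)\<bar> \<partial>std_exponential)"
    by (rule integral_abs_bound)
  also have "\<dots> \<le> (\<integral>s. \<bar>x - y\<bar> \<partial>std_exponential)"
  proof (rule integral_mono)
    show "\<bar>h (x + s) - h (y + s)\<bar> \<le> \<bar>x - y\<bar>" for s using h_diff[of "x + s" "y + s"] by simp
  qed (auto intro!: integrable_abs H_integrable Bochner_Integration.integrable_diff)
  finally show ?thesis using std_exponential.prob_space by simp
qed

lemma H_bound: "\<bar>H x\<bar> \<le> B"
proof -
  have "\<bar>H x\<bar> \<le> (\<integral>s. \<bar>h (x + s)\<bar> \<partial>std_exponential)"
    unfolding H_def by (rule integral_abs_bound)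
  also have "\<dots> \<le> (\<integral>s. B \<partial>std_exponential)"
    by (rule integral_mono) (auto intro: H_integrable bdd)
  finally show ?thesis using std_exponential.prob_space by simp
qed

text \<open>After the substitution \<open>t = x + s\<close> the variable \<open>x\<close> occurs
  only in the factor \<open>exp x\<close> and in the limit of integration, so \<open>H\<close> is
  differentiable although \<open>h\<close> need not be.\<close>

lemma H_tail: "H x = exp x * (\<integral>t. indicator {x..} t * (h t * exp (- t)) \<partial>lborel)"
  and tail_integrable: "integrable lborel (\<lambda>t. indicator {x..} t * (h t * exp (- t)))"
proof -
  have eq: "exponential_density 1 s * h (x + s) = exp x * (indicator {x..} (x + s) * (h (x + s) * exp (- (x + s))))" for s
    by (auto simp: exponential_density_def indicator_def simp flip: exp_add)
  have "H x = (\<integral>s. exponential_density 1 s * h (x + s) \<partial>lborel)"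
    unfolding H_def by (rule integral_real_density) (auto simp: exponential_density_nonneg)
  also have "\<dots> = exp x * (\<integral>s. indicator {x..} (x + s) * (h (x + s) * exp (- (x + s))) \<partial>lborel)"
    unfolding eq by (rule integral_mult_right_zero)
  also have "(\<integral>s. indicator {x..} (x + s) * (h (x + s) * exp (- (x + s))) \<partial>lborel) =
      (\<integral>t. indicator {x..} t * (h t * exp (- t)) \<partial>lborel)"
    using lborel_integral_real_affine[of 1 "\<lambda>t. indicator {x..} t * (h t * exp (- t))" x] by simp
  finally show "H x = exp x * (\<integral>t. indicator {x..} t * (h t * exp (- t)) \<partial>lborel)" .
  have "integrable lborel (\<lambda>s. exponential_density 1 s * h (x + s))"
    using H_integrable[of x] by (subst (asm) integrable_real_density) (auto simp: exponential_density_nonneg)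
  then have "integrable lborel (\<lambda>s. exp x * (indicator {x..} (x + s) * (h (x + s) * exp (- (x + s)))))"
    unfolding eq .
  then have "integrable lborel (\<lambda>s. indicator {x..} (x + 1 * s) * (h (x + 1 * s) * exp (- (x + 1 * s))))"
    by simp
  then show "integrable lborel (\<lambda>t. indicator {x..} t * (h t * exp (- t)))"
    by (subst lborel_integrable_real_affine_iff[of 1 _ x, symmetric]) auto
qed

text \<open>Cutting the tail integral at \<open>x\<close> leaves an integral over a compact
  interval, to which the fundamental theorem of calculus applies.\<close>

lemma H_eq:
  assumes "x \<ge> 0"
  shows "H x = exp x * (H 0 - integral {0..x} (\<lambda>t. h t * exp (- t)))"
proof -
  let ?f = "\<lambda>t. h t * exp (- t)"
  have int: "set_integrable lborel {0..x} ?f"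
    by (rule borel_integrable_atLeastAtMost') 
       (intro continuous_intros continuous_on_subset[OF h_cont], auto)
  have 1: "integral {0..x} ?f = (\<integral>t. indicator {0..x} t * ?f t \<partial>lborel)"
    using set_borel_integral_eq_integral(2)[OF int] by (simp add: set_lebesgue_integral_def)
  have "(\<integral>t. indicator {0..x} t * ?f t \<partial>lborel) + (\<integral>t. indicator {x..} t * ?f t \<partial>lborel) =
      (\<integral>t. indicator {0..x} t * ?f t + indicator {x..} t * ?f t \<partial>lborel)"
    using int tail_integrable by (subst Bochner_Integration.integral_add) (auto simp: set_integrable_def)
  also have "\<dots> = (\<integral>t. indicator {0..} t * ?f t \<partial>lborel)"
  proof (rule integral_cong_AE)
    have "AE t in lborel. t \<noteq> x" by (rule AE_lborel_singleton)
    then show "AE t in lborel. indicator {0..x} t * ?f t + indicator {x..} t * ?f t = indicator {0..} t * ?f t"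
      by eventually_elim (use assms in \<open>auto simp: indicator_def\<close>)
  qed auto
  also have "\<dots> = H 0" using H_tail[of 0] by simp
  finally have "(\<integral>t. indicator {x..} t * ?f t \<partial>lborel) = H 0 - integral {0..x} ?f" using 1 by linarith
  then show ?thesis by (simp only: H_tail[of x])
qed

lemma H_deriv:
  assumes "x > 0"
  shows "(H has_real_derivative (H x - h x)) (at x)"
proof -
  let ?f = "\<lambda>t. h t * exp (- t)"
  have "((\<lambda>u. integral {0..u} ?f) has_real_derivative ?f x) (at x within {0..x + 1})"
    using assms by (intro integral_has_real_derivative) 
       (auto intro!: continuous_intros continuous_on_subset[OF h_cont])
  then have d: "((\<lambda>u. integral {0..u} ?f) has_real_derivative ?f x) (at x)"
    using assms by (subst (asm) at_within_Icc_at) auto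
  have "((\<lambda>x. exp x * (H 0 - integral {0..x} ?f)) has_real_derivative
      exp x * (0 - ?f x) + exp x * (H 0 - integral {0..x} ?f)) (at x)"
    by (intro DERIV_mult' DERIV_exp DERIV_diff DERIV_const d)
  moreover have "exp x * (0 - ?f x) + exp x * (H 0 - integral {0..x} ?f) = H x - h x"
    unfolding H_eq[OF less_imp_le[OF assms]] by (simp add: exp_minus)
  ultimately have "((\<lambda>x. exp x * (H 0 - integral {0..x} ?f)) has_real_derivative H x - h x) (at x)"
    by simp
  moreover have "\<forall>\<^sub>F u in nhds x. exp u * (H 0 - integral {0..u} ?f) = H u"
  proof (rule eventually_mono)
    show "\<forall>\<^sub>F u in nhds x. u \<in> {0<..}"
      using assms by (intro eventually_nhds_in_open) auto
    show "exp u * (H 0 - integral {0..u} ?f) = H u" if "u \<in> {0<..}" for u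
      by (rule H_eq[symmetric]) (use that in simp)
  qed
  ultimately show ?thesis by (subst (asm) DERIV_cong_ev[OF refl _ refl])
qed

lemma H_mvt:
  assumes "0 \<le> x" "x < y"
  obtains z where "x < z" "z < y" "H y - H x = (y - x) * (H z - h z)"
proof -
  have "continuous_on {x..y} H"
  proof (rule lipschitz_on_continuous_on[of 1])
    show "1-lipschitz_on {x..y} H"
      by (rule lipschitz_onI) (use H_diff in \<open>auto simp: dist_real_def\<close>)
  qed
  moreover have "(H has_derivative (\<lambda>u. (H z - h z) * u)) (at z)" if "x < z" for z
    using H_deriv[of z] that assms by (simp add: has_field_derivative_def)
  ultimately obtain z where "z \<in> {x<..<y}" "H y - H x = (H z - h z) * (y - x)"
    using mvt[of x y H "\<lambda>z u. (H z - h z) * u"] assms(2) by auto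
  with that show thesis by (auto simp: mult.commute)
qed

text \<open>Stein's equation turns the error for \<open>h\<close> into the mean of
  \<open>g' - g\<close>. On the lattice of mesh \<open>\<delta> = 1 / b\<close>, \<open>b\<close>
  times a backward difference of \<open>g\<close> is a nearby value of \<open>g'\<close>, so
  \<open>stein_bound\<close> controls this mean up to discretisation.\<close>

lemma stein_bound_test:
  assumes Q: "stein_bound Q b \<epsilon>" "0 \<notin> set_pmf Q" and b: "b > 0"
  shows "\<bar>(\<integral>x. h (real x / b) \<partial>measure_pmf Q) - (\<integral>x. h x \<partial>std_exponential)\<bar> \<le> (4 * \<epsilon> + 2) / b"
proof -
  define \<delta> where "\<delta> = 1 / b"
  have \<delta>: "\<delta> > 0" using b by (simp add: \<delta>_def)
  define g where "g x = H 0 - H x" for x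
  define g' where "g' x = h x - H x" for x
  have mvt: "\<exists>z. x < z \<and> z < x + \<delta> \<and> g (x + \<delta>) - g x = \<delta> * g' z" if "x \<ge> 0" for x
  proof -
    have "x < x + \<delta>" using \<delta> by simp
    from H_mvt[OF that this] obtain z where "x < z" "z < x + \<delta>" "H (x + \<delta>) - H x = (x + \<delta> - x) * (H z - h z)" .
    then show ?thesis by (intro exI[of _ z]) (auto simp: g_def g'_def algebra_simps)
  qed
  have g'_diff: "\<bar>g' x - g' y\<bar> \<le> 2 * \<bar>x - y\<bar>" for x y
    using abs_triangle_ineq4[of "h x - h y" "H x - H y"] h_diff[of x y] H_diff[of x y]
    by (simp add: g'_def algebra_simps)
  \<comment> \<open>Consecutive differences of \<open>g\<close> are \<open>\<delta>\<close> times
    values of \<open>g'\<close> at points within \<open>2 * \<delta>\<close>, and \<open>g'\<close>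
    has Lipschitz constant 2. Hence the divisor \<open>4 * \<delta>\<^sup>2\<close> bounds the
    second differences of \<open>G\<close> by 1.\<close>
  define G where "G t = g (real t * \<delta>) / (4 * \<delta>\<^sup>2)" for t
  have gB: "\<bar>g x\<bar> \<le> 2 * B" for x
    using H_bound[of 0] H_bound[of x] unfolding g_def by linarith
  have G2: "\<bar>G (t + 2) - 2 * G (t + 1) + G t\<bar> \<le> 1" for t
  proof -
    obtain z1 where z1: "real t * \<delta> < z1" "z1 < real t * \<delta> + \<delta>"
      "g (real t * \<delta> + \<delta>) - g (real t * \<delta>) = \<delta> * g' z1"
      using mvt[of "real t * \<delta>"] \<delta> by auto
    obtain z2 where z2: "real t * \<delta> + \<delta> < z2" "z2 < real t * \<delta> + \<delta> + \<delta>"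
      "g (real t * \<delta> + \<delta> + \<delta>) - g (real t * \<delta> + \<delta>) = \<delta> * g' z2"
      using mvt[of "real t * \<delta> + \<delta>"] \<delta> by auto
    have "\<bar>g' z2 - g' z1\<bar> \<le> 2 * (2 * \<delta>)"
    proof -
      have "\<bar>z2 - z1\<bar> \<le> 2 * \<delta>" using z1(1,2) z2(1,2) by (simp add: abs_le_iff)
      then show ?thesis by (intro order_trans[OF g'_diff]) simp
    qed
    then have "\<delta> * \<bar>g' z2 - g' z1\<bar> \<le> \<delta> * (2 * (2 * \<delta>))"
      using \<delta> by (intro mult_left_mono) auto
    moreover have "G (t + 2) - 2 * G (t + 1) + G t = (\<delta> * g' z2 - \<delta> * g' z1) / (4 * \<delta>\<^sup>2)"
      unfolding G_def z1(3)[symmetric] z2(3)[symmetric] using \<delta>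
      by (simp add: algebra_simps add_divide_distrib diff_divide_distrib)
    ultimately show ?thesis
      using \<delta> by (simp add: abs_mult power2_eq_square flip: right_diff_distrib)
  qed
  have "\<bar>b * (\<integral>x. G x - G (x - 1) \<partial>measure_pmf Q) - ((\<integral>x. G x \<partial>measure_pmf Q) - G 0)\<bar> \<le> b * \<epsilon>"
  proof (rule Q(1)[unfolded stein_bound_def, rule_format, where B = "2 * B / (4 * \<delta>\<^sup>2)"])
    show "\<bar>G t\<bar> \<le> 2 * B / (4 * \<delta>\<^sup>2)" for t
      unfolding G_def using divide_right_mono[OF gB[of "real t * \<delta>"], of "4 * \<delta>\<^sup>2"] \<delta> by simp
  qed (use G2 in auto)
  then have "\<bar>(b * (\<integral>x. g (real x * \<delta>) - g (real (x - 1) * \<delta>) \<partial>measure_pmf Q) - (\<integral>x. g (real x * \<delta>) \<partial>measure_pmf Q)) / (4 * \<delta>\<^sup>2)\<bar> \<le> b * \<epsilon>"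
    by (simp add: G_def g_def flip: diff_divide_distrib)
  then have 1: "\<bar>b * (\<integral>x. g (real x * \<delta>) - g (real (x - 1) * \<delta>) \<partial>measure_pmf Q) - (\<integral>x. g (real x * \<delta>) \<partial>measure_pmf Q)\<bar> \<le> 4 * \<epsilon> / b"
      (is "\<bar>?X\<bar> \<le> _")
  proof -
    assume "\<bar>?X / (4 * \<delta>\<^sup>2)\<bar> \<le> b * \<epsilon>"
    then have "\<bar>?X\<bar> \<le> b * \<epsilon> * (4 * \<delta>\<^sup>2)"
      using \<delta> by (simp only: abs_divide) (simp add: pos_divide_le_eq)
    also have "\<dots> = 4 * \<epsilon> / b" using b by (simp add: \<delta>_def power2_eq_square)
    finally show ?thesis .
  qed
  have int: "integrable (measure_pmf Q) (\<lambda>x. g (f x))" for f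
    by (rule integrable_pmf_bounded[OF gB])
  have int': "integrable (measure_pmf Q) (\<lambda>x. g' (f x))" for f
  proof (rule integrable_pmf_bounded)
    show "\<bar>g' (f x)\<bar> \<le> 2 * B" for x
      using H_bound[of "f x"] bdd[of "f x"] unfolding g'_def by linarith
  qed
  \<comment> \<open>The intermediate point lies within \<open>\<delta>\<close> of
    \<open>x * \<delta>\<close>, which costs \<open>2 * \<delta>\<close>. As \<open>Q\<close> has no
    mass at 0, \<open>x - 1\<close> is not truncated.\<close>
  have "\<bar>(\<integral>x. b * (g (real x * \<delta>) - g (real (x - 1) * \<delta>)) \<partial>measure_pmf Q) - (\<integral>x. g' (real x * \<delta>) \<partial>measure_pmf Q)\<bar>
     \<le> (\<integral>x. 2 * \<delta> \<partial>measure_pmf Q)"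
  proof (rule expectation_diff_le)
    fix x assume x: "x \<in> set_pmf Q"
    then obtain y where y: "x = Suc y" using Q(2) by (cases x) auto
    obtain z where z: "real y * \<delta> < z" "z < real y * \<delta> + \<delta>"
      "g (real y * \<delta> + \<delta>) - g (real y * \<delta>) = \<delta> * g' z"
      using mvt[of "real y * \<delta>"] \<delta> by auto
    have "b * (g (real x * \<delta>) - g (real (x - 1) * \<delta>)) = b * \<delta> * g' z"
      using z(3) by (simp add: y algebra_simps)
    also have "b * \<delta> = 1" using b by (simp add: \<delta>_def)
    finally show "\<bar>b * (g (real x * \<delta>) - g (real (x - 1) * \<delta>)) - g' (real x * \<delta>)\<bar> \<le> 2 * \<delta>"
      using g'_diff[of z "real x * \<delta>"] z(1,2) by (simp add: y algebra_simps)
  qed (auto intro: int int')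
  then have 2: "\<bar>b * (\<integral>x. g (real x * \<delta>) - g (real (x - 1) * \<delta>) \<partial>measure_pmf Q) - (\<integral>x. g' (real x * \<delta>) \<partial>measure_pmf Q)\<bar> \<le> 2 / b"
    by (simp add: \<delta>_def)
  have "(\<integral>x. g' (real x * \<delta>) \<partial>measure_pmf Q) - (\<integral>x. g (real x * \<delta>) \<partial>measure_pmf Q) =
     (\<integral>x. g' (real x * \<delta>) - g (real x * \<delta>) \<partial>measure_pmf Q)"
    by (subst Bochner_Integration.integral_diff) (auto intro: int int')
  also have "\<dots> = (\<integral>x. h (real x / b) - H 0 \<partial>measure_pmf Q)"
    by (simp add: g_def g'_def \<delta>_def)
  also have "\<dots> = (\<integral>x. h (real x / b) \<partial>measure_pmf Q) - H 0"
    by (subst Bochner_Integration.integral_diff) (auto intro: integrable_pmf_bounded bdd)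
  finally have "(\<integral>x. h (real x / b) \<partial>measure_pmf Q) - H 0 =
    (\<integral>x. g' (real x * \<delta>) \<partial>measure_pmf Q) - (\<integral>x. g (real x * \<delta>) \<partial>measure_pmf Q)" ..
  moreover have "H 0 = (\<integral>x. h x \<partial>std_exponential)" by (simp add: H_def)
  moreover have "(4 * \<epsilon> + 2) / b = 4 * \<epsilon> / b + 2 / b" by (simp add: add_divide_distrib)
  ultimately show ?thesis using 1 2 by linarith
qed

end

text \<open>Clamping the argument to \<open>[-R, R]\<close> makes \<open>h\<close> bounded and keeps
  its Lipschitz constant; dominated convergence with majorant
  \<open>\<bar>h 0\<bar> + \<bar>x\<bar>\<close> lets \<open>R\<close> tend to infinity.\<close>

lemma stein_bound_lipschitz:
  assumes Q: "stein_bound Q b \<epsilon>" "0 \<notin> set_pmf Q" and b: "b > 0"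
    and int: "integrable (measure_pmf Q) real" and lip: "1-lipschitz_on UNIV h"
  shows "\<bar>(\<integral>x. h (real x / b) \<partial>measure_pmf Q) - (\<integral>x. h x \<partial>std_exponential)\<bar> \<le> (4 * \<epsilon> + 2) / b"
proof -
  define clamp where "clamp R x = max (- real R) (min (real R) x)" for R :: nat and x :: real
  have h_diff: "\<bar>h x - h y\<bar> \<le> \<bar>x - y\<bar>" for x y
    using lipschitz_onD[OF lip, of x y] by (simp add: dist_real_def)
  have cont: "continuous_on UNIV h"
    by (rule lipschitz_on_continuous_on[OF lip])
  have [measurable]: "h \<in> borel_measurable borel"
    by (rule borel_measurable_continuous_onI[OF cont])
  have [measurable]: "clamp R \<in> borel_measurable borel" for R
    unfolding clamp_def by measurable
  have bound: "\<bar>h (clamp R x)\<bar> \<le> \<bar>h 0\<bar> + \<bar>x\<bar>" for R x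
  proof -
    have "\<bar>clamp R x\<bar> \<le> \<bar>x\<bar>" by (auto simp: clamp_def)
    then show ?thesis using h_diff[of "clamp R x" 0] by linarith
  qed
  have lim: "(\<lambda>R. h (clamp R x)) \<longlonglongrightarrow> h x" for x
  proof (rule tendsto_eventually)
    obtain n :: nat where "\<bar>x\<bar> \<le> real n" using real_arch_simple by blast
    then have "clamp R x = x" if "R \<ge> n" for R
      using that by (auto simp: clamp_def)
    then show "\<forall>\<^sub>F R in sequentially. h (clamp R x) = h x"
      by (intro eventually_sequentiallyI[of n]) auto
  qed
  have *: "\<bar>(\<integral>x. h (clamp R (real x / b)) \<partial>measure_pmf Q) - (\<integral>x. h (clamp R x) \<partial>std_exponential)\<bar> \<le> (4 * \<epsilon> + 2) / b" for R
  proof -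
    interpret bounded_lipschitz_test "\<lambda>x. h (clamp R x)" "\<bar>h 0\<bar> + real R"
    proof
      show "1-lipschitz_on UNIV (\<lambda>x. h (clamp R x))"
      proof (rule lipschitz_onI)
        fix x y
        have "\<bar>clamp R x - clamp R y\<bar> \<le> \<bar>x - y\<bar>" by (auto simp: clamp_def)
        then show "dist (h (clamp R x)) (h (clamp R y)) \<le> 1 * dist x y"
          using h_diff[of "clamp R x" "clamp R y"] by (simp add: dist_real_def)
      qed simp
      show "\<bar>h (clamp R x)\<bar> \<le> \<bar>h 0\<bar> + real R" for x
      proof -
        have "\<bar>clamp R x\<bar> \<le> real R" by (auto simp: clamp_def)
        then show ?thesis using h_diff[of "clamp R x" 0] by linarith
      qed
    qed
    show ?thesis by (rule stein_bound_test[OF Q b])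
  qed
  have "(\<lambda>R. \<integral>x. h (clamp R (real x / b)) \<partial>measure_pmf Q) \<longlonglongrightarrow> (\<integral>x. h (real x / b) \<partial>measure_pmf Q)"
  proof (rule integral_dominated_convergence)
    show "integrable (measure_pmf Q) (\<lambda>x. \<bar>h 0\<bar> + \<bar>real x / b\<bar>)"
      using int by auto
    show "AE x in measure_pmf Q. norm (h (clamp R (real x / b))) \<le> \<bar>h 0\<bar> + \<bar>real x / b\<bar>" for R
      unfolding real_norm_def by (intro AE_I2 bound)
  qed (use lim in auto)
  moreover have "(\<lambda>R. \<integral>x. h (clamp R x) \<partial>std_exponential) \<longlonglongrightarrow> (\<integral>x. h x \<partial>std_exponential)"
  proof (rule integral_dominated_convergence)
    show "integrable std_exponential (\<lambda>x. \<bar>h 0\<bar> + \<bar>x\<bar>)"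
      using integrable_std_exponential_id by (intro Bochner_Integration.integrable_add integrable_abs) auto
  qed (use lim bound in auto)
  ultimately show ?thesis
    using * by (intro LIMSEQ_le_const2[OF tendsto_rabs[OF tendsto_diff]]) auto
qed


section \<open>The law of the process\<close>

text \<open>The recursion peels off the oldest generation, the order in which survivors are
  decomposed later; therefore the generation \<open>k\<close> of the ancestor is a
  parameter.\<close>

primrec gw_law :: "(nat \<Rightarrow> nat pmf) \<Rightarrow> nat \<Rightarrow> nat \<Rightarrow> nat pmf" where
  "gw_law q 0 k = return_pmf 1"
| "gw_law q (Suc l) k = compound (q (Suc k)) (gw_law q l (Suc k))"

text \<open>The process itself grows at the youngest generation; associativity of
  \<open>compound\<close> translates between the two orders.\<close>

lemma gw_law_last: "gw_law q (Suc l) k = compound (gw_law q l k) (q (k + Suc l))"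
proof (induction l arbitrary: k)
  case (Suc l)
  have "gw_law q (Suc (Suc l)) k = compound (q (Suc k)) (gw_law q (Suc l) (Suc k))"
    by simp
  also have "\<dots> = compound (compound (q (Suc k)) (gw_law q l (Suc k))) (q (Suc k + Suc l))"
    unfolding Suc.IH by (simp add: compound_assoc)
  finally show ?case by simp
qed simp

text \<open>Splitting along the countably many values of \<open>Y\<close> makes the index
  deterministic, and independence factorises each piece.\<close>

lemma (in prob_space) distr_indep_bind:
  fixes Y :: "'a \<Rightarrow> nat" and U :: "nat \<Rightarrow> 'a \<Rightarrow> nat"
  assumes Y [measurable]: "Y \<in> measurable M (count_space UNIV)"
    and U [measurable]: "\<And>x. U x \<in> measurable M (count_space UNIV)"
    and indep: "\<And>x. indep_var (count_space UNIV) Y (count_space UNIV) (U x)"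
    and P: "distr M (count_space UNIV) Y = measure_pmf P"
    and K: "\<And>x. distr M (count_space UNIV) (U x) = measure_pmf (K x)"
  shows "distr M (count_space UNIV) (\<lambda>\<omega>. U (Y \<omega>) \<omega>) = measure_pmf (bind_pmf P K)"
proof (rule measure_eqI_countable[where A = UNIV])
  fix y
  have UY [measurable]: "(\<lambda>\<omega>. U (Y \<omega>) \<omega>) \<in> measurable M (count_space UNIV)"
    by (rule measurable_compose_countable) auto
  have "emeasure (distr M (count_space UNIV) (\<lambda>\<omega>. U (Y \<omega>) \<omega>)) {y} =
      emeasure M ((\<lambda>\<omega>. U (Y \<omega>) \<omega>) -` {y} \<inter> space M)"
    by (simp add: emeasure_distr)
  also have "(\<lambda>\<omega>. U (Y \<omega>) \<omega>) -` {y} \<inter> space M = (\<Union>x. (Y -` {x} \<inter> space M) \<inter> (U x -` {y} \<inter> space M))"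
    by auto
  also have "emeasure M \<dots> = (\<Sum>x. emeasure M ((Y -` {x} \<inter> space M) \<inter> (U x -` {y} \<inter> space M)))"
    by (rule suminf_emeasure[symmetric]) (auto simp: disjoint_family_on_def)
  also have "\<dots> = (\<Sum>x. ennreal (pmf P x) * emeasure (K x) {y})"
  proof (intro suminf_cong)
    fix x
    have "(Y -` {x} \<inter> space M) \<inter> (U x -` {y} \<inter> space M) = (\<lambda>\<omega>. (Y \<omega>, U x \<omega>)) -` ({x} \<times> {y}) \<inter> space M"
      by auto
    then have "measure M ((Y -` {x} \<inter> space M) \<inter> (U x -` {y} \<inter> space M)) =
        measure M (Y -` {x} \<inter> space M) * measure M (U x -` {y} \<inter> space M)"
      using indep_varD[OF indep[of x], of "{x}" "{y}"] by simp
    moreover have "measure M (Y -` {x} \<inter> space M) = pmf P x"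
      using measure_distr[OF Y, of "{x}"] by (simp add: P measure_pmf_single)
    moreover have "measure M (U x -` {y} \<inter> space M) = pmf (K x) y"
      using measure_distr[OF U[of x], of "{y}"] by (simp add: K measure_pmf_single)
    ultimately show "emeasure M ((Y -` {x} \<inter> space M) \<inter> (U x -` {y} \<inter> space M)) =
        ennreal (pmf P x) * emeasure (K x) {y}"
      by (simp add: emeasure_eq_measure emeasure_pmf_single ennreal_mult)
  qed
  also have "\<dots> = emeasure (bind_pmf P K) {y}"
    by (simp add: nn_integral_measure_pmf nn_integral_count_space_nat)
  finally show "emeasure (distr M (count_space UNIV) (\<lambda>\<omega>. U (Y \<omega>) \<omega>)) {y} = emeasure (bind_pmf P K) {y}" .
qed auto

section \<open>Independence of the generations and the law of the process\<close>

context gwve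
begin

text \<open>The offspring numbers become a point of a product space, so that quantities depending on
  disjoint index sets are functions of independent variables.\<close>

definition history :: "(nat \<times> nat) set \<Rightarrow> 'w \<Rightarrow> nat \<times> nat \<Rightarrow> nat" where
  "history A \<omega> = restrict (\<lambda>(i, n). \<xi> i n \<omega>) A"

abbreviation "history_space A \<equiv> PiM A (\<lambda>_. count_space (UNIV :: nat set))"

lemma indep_history:
  assumes "A \<inter> B = {}" "A \<subseteq> {1..} \<times> {1..}" "B \<subseteq> {1..} \<times> {1..}"
    and "f \<in> measurable (history_space A) (count_space UNIV)"
    and "g \<in> measurable (history_space B) (count_space UNIV)"
  shows "indep_var (count_space UNIV) (\<lambda>\<omega>. f (history A \<omega>)) (count_space UNIV) (\<lambda>\<omega>. g (history B \<omega>))"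
proof -
  have "indep_var (history_space A) (history A) (history_space B) (history B)"
    using indep_var_restrict[OF offspring_indep assms(1-3)]
    by (simp add: history_def[abs_def] case_prod_beta')
  from indep_var_compose[OF this assms(4,5)] show ?thesis by (simp add: comp_def)
qed

lemma measurable_offspring [measurable]:
  assumes "i \<ge> 1" "n \<ge> 1"
  shows "\<xi> i n \<in> measurable M (count_space UNIV)"
proof -
  have "random_variable (count_space UNIV) (case (i, n) of (i, n) \<Rightarrow> \<xi> i n)"
    using assms offspring_indep unfolding indep_vars_def2 by fastforce
  then show ?thesis by simp
qed

lemma measurable_coordinate:
  "x \<in> A \<Longrightarrow> (\<lambda>\<eta>. \<eta> x) \<in> measurable (history_space A) (count_space UNIV)"
  by (rule measurable_component_singleton)

lemma measurable_generation_sum: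
  fixes j n :: nat
  assumes "\<And>i. i \<ge> 1 \<Longrightarrow> i \<le> j \<Longrightarrow> (i, n) \<in> A"
  shows "(\<lambda>\<eta>. \<Sum>i = 1..j. \<eta> (i, n)) \<in> measurable (history_space A) (count_space UNIV)"
  using assms
proof (induction j)
  case (Suc j)
  have 1: "(\<lambda>\<eta>. \<Sum>i = 1..j. \<eta> (i, n)) \<in> measurable (history_space A) (count_space UNIV)"
    using Suc by simp
  have 2: "(\<lambda>\<eta>. x + \<eta> (Suc j, n)) \<in> measurable (history_space A) (count_space UNIV)" for x
    by (rule measurable_compose[OF measurable_coordinate]) (use Suc in auto)
  have "(\<lambda>\<eta>. (\<Sum>i = 1..j. \<eta> (i, n)) + \<eta> (Suc j, n)) \<in> measurable (history_space A) (count_space UNIV)"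
    by (rule measurable_compose_countable[OF 2 1])
  then show ?case by simp
qed simp

text \<open>Running the recursion on coordinates exhibits the process at time \<open>n\<close> as a
  function of the generations up to \<open>n\<close>, hence as independent of the next one.\<close>

lemma measurable_gw_process_history:
  assumes "\<And>i k. i \<ge> 1 \<Longrightarrow> k \<ge> 1 \<Longrightarrow> k \<le> n \<Longrightarrow> (i, k) \<in> A"
  shows "gw_process (\<lambda>i k \<eta>. \<eta> (i, k)) n \<in> measurable (history_space A) (count_space UNIV)"
  using assms
proof (induction n)
  case 0
  have "gw_process (\<lambda>i k \<eta>. \<eta> (i, k)) 0 = (\<lambda>_ :: nat \<times> nat \<Rightarrow> nat. 1)" by (simp add: fun_eq_iff)
  then show ?case by simp
next
  case (Suc n)
  have IH: "gw_process (\<lambda>i k \<eta>. \<eta> (i, k)) n \<in> measurable (history_space A) (count_space UNIV)"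
    by (rule Suc.IH) (use Suc.prems in auto)
  have "(\<lambda>\<eta>. \<Sum>i = 1..gw_process (\<lambda>i k \<eta>. \<eta> (i, k)) n \<eta>. \<eta> (i, Suc n)) \<in> measurable (history_space A) (count_space UNIV)"
    by (rule measurable_compose_countable[OF measurable_generation_sum IH]) (use Suc.prems in auto)
  moreover have "gw_process (\<lambda>i k \<eta>. \<eta> (i, k)) (Suc n) =
      (\<lambda>\<eta>. \<Sum>i = 1..gw_process (\<lambda>i k \<eta>. \<eta> (i, k)) n \<eta>. \<eta> (i, Suc n))"
    by (simp add: fun_eq_iff)
  ultimately show ?case by simp
qed

lemma gw_process_history:
  assumes "\<And>i k. i \<ge> 1 \<Longrightarrow> k \<ge> 1 \<Longrightarrow> k \<le> n \<Longrightarrow> (i, k) \<in> A"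
  shows "gw_process \<xi> n \<omega> = gw_process (\<lambda>i k \<eta>. \<eta> (i, k)) n (history A \<omega>)"
  using assms
  by (induction n) (auto simp: history_def intro!: sum.cong)

lemma measurable_history [measurable]:
  "A \<subseteq> {1..} \<times> {1..} \<Longrightarrow> history A \<in> measurable M (history_space A)"
  unfolding history_def[abs_def] by (rule measurable_restrict) auto

lemma generation_sum_law:
  assumes n: "n \<ge> 1"
  shows "distr M (count_space UNIV) (\<lambda>\<omega>. \<Sum>i = 1..j. \<xi> i n \<omega>) = measure_pmf (iid_sum (q n) j)"
proof (induction j)
  case 0
  have "distr M (count_space UNIV) (\<lambda>\<omega>. 0::nat) = return (count_space UNIV) 0"
    by (rule distr_const) simp
  then show ?case by (simp add: return_pmf.rep_eq)
next
  case (Suc j)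
  have [measurable]: "(\<lambda>\<omega>. \<Sum>i = 1..j. \<xi> i n \<omega>) \<in> measurable M (count_space UNIV)"
    using n by (induction j) auto
  have m [measurable]: "\<xi> (Suc j) n \<in> measurable M (count_space UNIV)"
    using n by auto
  have "distr M (count_space UNIV) (\<lambda>\<omega>. (\<Sum>i = 1..j. \<xi> i n \<omega>) + \<xi> (Suc j) n \<omega>) =
      measure_pmf (bind_pmf (iid_sum (q n) j) (\<lambda>x. map_pmf ((+) x) (q n)))"
  proof (rule distr_indep_bind[where U = "\<lambda>x \<omega>. x + \<xi> (Suc j) n \<omega>"])
    fix x
    let ?A = "{1..j} \<times> {n}" and ?B = "{(Suc j, n)}"
    have "indep_var (count_space UNIV) (\<lambda>\<omega>. (\<lambda>\<eta>. \<Sum>i = 1..j. \<eta> (i, n)) (history ?A \<omega>))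
        (count_space UNIV) (\<lambda>\<omega>. (\<lambda>\<eta>. x + \<eta> (Suc j, n)) (history ?B \<omega>))"
    proof (rule indep_history)
      show "(\<lambda>\<eta>. x + \<eta> (Suc j, n)) \<in> measurable (history_space ?B) (count_space UNIV)"
        by (rule measurable_compose[OF measurable_coordinate]) auto
    qed (use n in \<open>auto intro!: measurable_generation_sum\<close>)
    then show "indep_var (count_space UNIV) (\<lambda>\<omega>. \<Sum>i = 1..j. \<xi> i n \<omega>) (count_space UNIV) (\<lambda>\<omega>. x + \<xi> (Suc j) n \<omega>)"
      by (simp add: history_def)
    have "distr M (count_space UNIV) (\<lambda>\<omega>. x + \<xi> (Suc j) n \<omega>) =
        distr (distr M (count_space UNIV) (\<xi> (Suc j) n)) (count_space UNIV) ((+) x)"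
      by (subst distr_distr) (auto simp: comp_def)
    also have "\<dots> = measure_pmf (map_pmf ((+) x) (q n))"
      using n by (simp add: offspring_law map_pmf_rep_eq)
    finally show "distr M (count_space UNIV) (\<lambda>\<omega>. x + \<xi> (Suc j) n \<omega>) = measure_pmf (map_pmf ((+) x) (q n))" .
  next
    show "(\<lambda>\<omega>. \<Sum>i = 1..j. \<xi> i n \<omega>) \<in> measurable M (count_space UNIV)" by measurable
    show "(\<lambda>\<omega>. x + \<xi> (Suc j) n \<omega>) \<in> measurable M (count_space UNIV)" for x by measurable
  qed (use Suc in simp)
  then show ?case by simp
qed

lemma measurable_gw_process [measurable]: "gw_process \<xi> n \<in> measurable M (count_space UNIV)"
proof -
  let ?A = "{1..} \<times> {1..n}"
  have "(\<lambda>\<omega>. gw_process (\<lambda>i k \<eta>. \<eta> (i, k)) n (history ?A \<omega>)) \<in> measurable M (count_space UNIV)"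
    by (rule measurable_compose[OF measurable_history measurable_gw_process_history]) auto
  then show ?thesis
    by (subst (asm) gw_process_history[symmetric]) auto
qed

lemma gw_process_law: "distr M (count_space UNIV) (gw_process \<xi> n) = measure_pmf (gw_law q n 0)"
proof (induction n)
  case 0
  have "gw_process \<xi> 0 = (\<lambda>_. 1)" by (simp add: fun_eq_iff)
  moreover have "distr M (count_space UNIV) (\<lambda>\<omega>. 1::nat) = return (count_space UNIV) 1"
    by (rule distr_const) simp
  ultimately show ?case by (simp add: return_pmf.rep_eq)
next
  case (Suc n)
  have "distr M (count_space UNIV) (\<lambda>\<omega>. \<Sum>i = 1..gw_process \<xi> n \<omega>. \<xi> i (Suc n) \<omega>) =
     measure_pmf (bind_pmf (gw_law q n 0) (iid_sum (q (Suc n))))"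
  proof (rule distr_indep_bind[where U = "\<lambda>j \<omega>. \<Sum>i = 1..j. \<xi> i (Suc n) \<omega>"])
    fix j
    show "(\<lambda>\<omega>. \<Sum>i = 1..j. \<xi> i (Suc n) \<omega>) \<in> measurable M (count_space UNIV)"
      by (induction j) auto
    let ?A = "{1..} \<times> {1..n}" and ?B = "{1..j} \<times> {Suc n}"
    have "indep_var (count_space UNIV) (\<lambda>\<omega>. gw_process (\<lambda>i k \<eta>. \<eta> (i, k)) n (history ?A \<omega>))
        (count_space UNIV) (\<lambda>\<omega>. (\<lambda>\<eta>. \<Sum>i = 1..j. \<eta> (i, Suc n)) (history ?B \<omega>))"
      by (rule indep_history) (auto intro!: measurable_generation_sum measurable_gw_process_history)
    then show "indep_var (count_space UNIV) (gw_process \<xi> n) (count_space UNIV) (\<lambda>\<omega>. \<Sum>i = 1..j. \<xi> i (Suc n) \<omega>)"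
      by (subst (asm) gw_process_history[symmetric]) (auto simp: history_def)
  qed (use Suc generation_sum_law in auto)
  moreover have "gw_process \<xi> (Suc n) = (\<lambda>\<omega>. \<Sum>i = 1..gw_process \<xi> n \<omega>. \<xi> i (Suc n) \<omega>)"
    by (simp add: fun_eq_iff)
  ultimately show ?case
    by (simp only: gw_law_last) (simp add: compound_def)
qed

lemma cond_survival_law:
  assumes "measure (gw_law q n 0) {0<..} > 0"
  shows "distr (cond_survival M \<xi> n) (count_space UNIV) (gw_process \<xi> n) =
    measure_pmf (cond_pmf (gw_law q n 0) {0<..})"
proof (rule measure_eqI_countable[where A = UNIV])
  let ?Z = "gw_process \<xi> n"
  fix y
  have S: "{\<omega> \<in> space M. ?Z \<omega> > 0} = ?Z -` {0<..} \<inter> space M" by auto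
  have E: "emeasure M (?Z -` X \<inter> space M) = ennreal (measure (gw_law q n 0) X)" for X
    using emeasure_distr[OF measurable_gw_process, of X n]
    by (simp add: gw_process_law measure_pmf.emeasure_eq_measure)
  have "emeasure (distr (cond_survival M \<xi> n) (count_space UNIV) ?Z) {y} =
      emeasure (cond_survival M \<xi> n) (?Z -` {y} \<inter> space M)"
    by (subst emeasure_distr) (simp_all add: cond_survival_def)
  also have "\<dots> = emeasure M ((?Z -` {0<..} \<inter> space M) \<inter> (?Z -` {y} \<inter> space M)) / emeasure M (?Z -` {0<..} \<inter> space M)"
    unfolding cond_survival_def S by (rule emeasure_uniform_measure) auto
  also have "(?Z -` {0<..} \<inter> space M) \<inter> (?Z -` {y} \<inter> space M) = ?Z -` ({0<..} \<inter> {y}) \<inter> space M"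
    by auto
  also have "emeasure M \<dots> / emeasure M (?Z -` {0<..} \<inter> space M) =
      ennreal (measure (gw_law q n 0) ({0<..} \<inter> {y}) / measure (gw_law q n 0) {0<..})"
    unfolding E using assms by (simp add: divide_ennreal)
  also have "\<dots> = emeasure (cond_pmf (gw_law q n 0) {0<..}) {y}"
    unfolding emeasure_pmf_single pmf_cond[OF set_cond_pos[OF assms]]
    by (cases y) (auto simp: measure_pmf_single)
  finally show "emeasure (distr (cond_survival M \<xi> n) (count_space UNIV) ?Z) {y} =
      emeasure (cond_pmf (gw_law q n 0) {0<..}) {y}" .
qed auto

lemma yaglom_law_eq:
  assumes "measure (gw_law q n 0) {0<..} > 0"
  shows "cond_mean M \<xi> n = (\<integral>x. real x \<partial>cond_pmf (gw_law q n 0) {0<..})"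
    and "yaglom_law M \<xi> n = distr (cond_pmf (gw_law q n 0) {0<..}) borel (\<lambda>x. real x / cond_mean M \<xi> n)"
proof -
  have [measurable]: "gw_process \<xi> n \<in> measurable (cond_survival M \<xi> n) (count_space UNIV)"
    by (simp add: cond_survival_def)
  show "cond_mean M \<xi> n = (\<integral>x. real x \<partial>cond_pmf (gw_law q n 0) {0<..})"
    unfolding cond_mean_def cond_survival_law[OF assms, symmetric] by (subst integral_distr) auto
  show "yaglom_law M \<xi> n = distr (cond_pmf (gw_law q n 0) {0<..}) borel (\<lambda>x. real x / cond_mean M \<xi> n)"
    unfolding yaglom_law_def cond_survival_law[OF assms, symmetric] by (subst distr_distr) (auto simp: comp_def)
qed

end


section \<open>Survivors along the generations\<close>

locale environment =
  fixes q :: "nat \<Rightarrow> nat pmf" and a c :: real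
  assumes offspring: "n \<ge> 1 \<Longrightarrow> offspring (q n) (f1 q n) (f2 q n) (enn2real (pgf_deriv 3 (q n) 1)) c"
    and a_pos: "a > 0" and f2_ge: "n \<ge> 1 \<Longrightarrow> f2 q n \<ge> a"
begin

lemma f1_pos: "n \<ge> 1 \<Longrightarrow> f1 q n > 0"
  by (rule offspring.m_pos[OF offspring])

lemma f2_pos: "n \<ge> 1 \<Longrightarrow> f2 q n > 0"
  by (rule offspring.s_pos[OF offspring])

lemma c_ge_1: "c \<ge> 1"
  by (rule offspring.c_ge_1[OF offspring[of 1]]) simp

lemma f2_le: "n \<ge> 1 \<Longrightarrow> f2 q n \<le> 4 * c * (1 + f1 q n) * f1 q n"
  by (rule offspring.moment2_le[OF offspring])

lemma mu_pos: "mu q n > 0"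
  unfolding mu_def by (intro prod_pos) (auto intro: f1_pos)

lemma mu_Suc: "mu q (Suc n) = mu q n * f1 q (Suc n)"
  by (simp add: mu_def)

lemma rho_Suc: "rho q (Suc n) = rho q n + f2 q (Suc n) / (f1 q (Suc n) * mu q (Suc n))"
  by (simp add: rho_def nu_def mu_Suc power2_eq_square mult.commute mult.left_commute)

lemma rho_increment_pos: "rho q (Suc n) - rho q n > 0"
  using f2_pos[of "Suc n"] f1_pos[of "Suc n"] mu_pos[of "Suc n"] by (simp add: rho_Suc)

lemma rho_mono: "m \<le> n \<Longrightarrow> rho q m \<le> rho q n"
  by (rule lift_Suc_mono_le[of "rho q"]) (use rho_increment_pos in \<open>auto intro: less_imp_le simp: algebra_simps\<close>)

lemma rho_nonneg: "rho q n \<ge> 0"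
  using rho_mono[of 0 n] by (simp add: rho_def)

lemma rho_pos: "n \<ge> 1 \<Longrightarrow> rho q n > 0"
  using rho_nonneg[of "n - 1"] rho_increment_pos[of "n - 1"] by simp

text \<open>With \<open>n = k + l\<close> this is the \<open>p_k\<close> of the overview, and
  \<open>alive\<close> is its \<open>Q_k\<close>; \<open>l\<close> counts the remaining
  generations.\<close>

definition surv :: "nat \<Rightarrow> nat \<Rightarrow> real" where
  "surv l k = measure (gw_law q l k) {0<..}"

definition alive :: "nat \<Rightarrow> nat \<Rightarrow> nat pmf" where
  "alive l k = cond_pmf (gw_law q l k) {0<..}"

lemma surv_le_1: "surv l k \<le> 1"
  unfolding surv_def by (rule measure_pmf.prob_le_1)

lemma alive_pos: "surv l k > 0 \<Longrightarrow> 0 \<notin> set_pmf (alive l k)"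
  using set_cond_pos[of "gw_law q l k"] by (simp add: alive_def surv_def set_cond_pmf)

lemma surv_0 [simp]: "surv 0 k = 1"
  by (simp add: surv_def measure_return_pmf)

lemma alive_0 [simp]: "alive 0 k = return_pmf 1"
proof -
  have "set_pmf (alive 0 k) \<subseteq> {1}"
    using set_cond_pos[of "gw_law q 0 k"] by (auto simp: alive_def set_cond_pmf measure_return_pmf)
  then show ?thesis by (simp add: set_pmf_subset_singleton)
qed

abbreviation "survivors l k \<equiv> cond_pmf (compound (q (Suc k)) (bern (surv l (Suc k)))) {0<..}"

text \<open>Splitting off extinction from each child's line yields a Bernoulli factor, which
  associativity moves onto the offspring law as a thinning. Splitting the thinned law again leaves a
  Bernoulli factor in front of a positive law, from which \<open>surv\<close> and
  \<open>alive\<close> are read off.\<close>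

lemma alive_step:
  assumes p: "surv l (Suc k) > 0"
  shows "thinned_offspring (q (Suc k)) (f1 q (Suc k)) (f2 q (Suc k)) (enn2real (pgf_deriv 3 (q (Suc k)) 1)) c
      (surv l (Suc k)) (surv (Suc l) k)"
    and "alive (Suc l) k = compound (survivors l k) (alive l (Suc k))"
proof -
  let ?T = "compound (q (Suc k)) (bern (surv l (Suc k)))"
  let ?\<pi> = "measure (measure_pmf ?T) {0<..}"
  interpret offspring "q (Suc k)" "f1 q (Suc k)" "f2 q (Suc k)" "enn2real (pgf_deriv 3 (q (Suc k)) 1)" c
    by (rule offspring) simp
  interpret thinned_offspring "q (Suc k)" "f1 q (Suc k)" "f2 q (Suc k)" "enn2real (pgf_deriv 3 (q (Suc k)) 1)" c
    "surv l (Suc k)" ?\<pi>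
    by unfold_locales (use p surv_le_1 in auto)
  have "gw_law q (Suc l) k = compound (q (Suc k)) (compound (bern (surv l (Suc k))) (alive l (Suc k)))"
    using compound_bern_cond[of "gw_law q l (Suc k)"] p by (simp add: surv_def alive_def)
  also have "\<dots> = compound ?T (alive l (Suc k))"
    by (simp add: compound_assoc)
  also have "\<dots> = compound (compound (bern ?\<pi>) (survivors l k)) (alive l (Suc k))"
    using compound_bern_cond[of ?T] \<pi>_pos by simp
  finally have law: "gw_law q (Suc l) k = compound (bern ?\<pi>) (compound (survivors l k) (alive l (Suc k)))"
    by (simp only: compound_assoc)
  have pos: "0 \<notin> set_pmf (compound (survivors l k) (alive l (Suc k)))"
    by (intro compound_pos N_pos alive_pos p)
  have surv: "surv (Suc l) k = ?\<pi>"
    unfolding surv_def[of "Suc l"] law by (rule measure_compound_bern) (use \<pi>_pos \<pi>_le_1 pos in auto)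
  show "thinned_offspring (q (Suc k)) (f1 q (Suc k)) (f2 q (Suc k)) (enn2real (pgf_deriv 3 (q (Suc k)) 1)) c
      (surv l (Suc k)) (surv (Suc l) k)"
    unfolding surv by (rule thinned_offspring_axioms)
  show "alive (Suc l) k = compound (survivors l k) (alive l (Suc k))"
    unfolding alive_def[of "Suc l"] law by (rule cond_compound_bern) (use \<pi>_pos \<pi>_le_1 pos in auto)
qed

lemma surv_pos: "surv l k > 0"
proof (induction l arbitrary: k)
  case (Suc l)
  show ?case by (rule thinned_offspring.\<pi>_pos[OF alive_step(1)[OF Suc]])
qed simp

lemmas thinned = alive_step(1)[OF surv_pos]
lemmas alive_Suc = alive_step(2)[OF surv_pos]

text \<open>Extinct lines add nothing to the mean, so the conditional mean is the mean
  \<open>mu q (k + l) / mu q k\<close> over the survival probability.\<close>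

definition alive_mean :: "nat \<Rightarrow> nat \<Rightarrow> real" where
  "alive_mean l k = mu q (k + l) / (mu q k * surv l k)"

text \<open>This is the recursion \<open>\<epsilon> + b * W\<close> of
  \<open>stein_bound_compound\<close>, with \<open>W\<close> taken from
  \<open>equilibrium_bound_N\<close>.\<close>

primrec stein_error :: "nat \<Rightarrow> nat \<Rightarrow> real" where
  "stein_error 0 k = 0"
| "stein_error (Suc l) k = stein_error l (Suc k) + alive_mean l (Suc k) *
    (10 * c * (1 + f1 q (Suc k)) * f2 q (Suc k) * (surv l (Suc k))\<^sup>2 / f1 q (Suc k))"

lemma alive_mean_pos: "alive_mean l k > 0"
  by (simp add: alive_mean_def mu_pos surv_pos)

lemma alive_mean_Suc:
  "alive_mean (Suc l) k = alive_mean l (Suc k) * (f1 q (Suc k) * surv l (Suc k) / surv (Suc l) k)"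
  using mu_pos[of k] surv_pos[of l "Suc k"] surv_pos[of "Suc l" k] f1_pos[of "Suc k"]
  by (simp add: alive_mean_def mu_Suc)

lemma integrable_compound:
  assumes "integrable (measure_pmf R) real" "integrable (measure_pmf P) real"
  shows "integrable (measure_pmf (compound R P)) real"
    and "(\<integral>x. real x \<partial>compound R P) = (\<integral>x. real x \<partial>R) * (\<integral>x. real x \<partial>P)"
proof -
  have *: "(\<integral>\<^sup>+x. ennreal (real x) \<partial>compound R P) = ennreal ((\<integral>x. real x \<partial>R) * (\<integral>x. real x \<partial>P))"
    using assms by (simp add: nn_integral_compound nn_integral_eq_integral ennreal_mult)
  show "integrable (measure_pmf (compound R P)) real"
    by (rule integrableI_nn_integral_finite[OF _ _ *]) auto
  show "(\<integral>x. real x \<partial>compound R P) = (\<integral>x. real x \<partial>R) * (\<integral>x. real x \<partial>P)"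
    by (rule integral_eq_nn_integral[THEN trans]) (use * in auto)
qed

lemma alive_moments:
  shows "integrable (measure_pmf (alive l k)) real"
    and "(\<integral>x. real x \<partial>alive l k) = alive_mean l k"
    and "stein_bound (alive l k) (alive_mean l k) (stein_error l k)"
proof (induction l arbitrary: k)
  case 0
  { case 1 show ?case by (simp add: integrable_measure_pmf_finite) next
    case 2 show ?case using mu_pos[of k] by (simp add: alive_mean_def) next
    case 3 show ?case using mu_pos[of k] stein_bound_return_1 by (simp add: alive_mean_def) }
next
  case (Suc l)
  interpret thinned_offspring "q (Suc k)" "f1 q (Suc k)" "f2 q (Suc k)" "enn2real (pgf_deriv 3 (q (Suc k)) 1)" c
    "surv l (Suc k)" "surv (Suc l) k" for k
    by (rule thinned)
  { case 1 show ?case unfolding alive_Suc by (intro integrable_compound N_moments Suc)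
  next
    case 2 show ?case
      unfolding alive_Suc integrable_compound(2)[OF N_moments(1) Suc(1)] N_moments(2) Suc(2) alive_mean_Suc
      by simp
  next
    case 3
    show ?case
      unfolding alive_Suc alive_mean_Suc stein_error.simps
      by (rule stein_bound_compound[OF Suc(3) alive_pos[OF surv_pos] alive_mean_pos Suc(1,2)
          equilibrium_bound_N N_pos _ N_moments(1,2)])
        (use f1_pos[of "Suc k"] surv_pos in simp) }
qed

section \<open>Survival probabilities and the accumulated error\<close>

definition tail_rho :: "nat \<Rightarrow> nat \<Rightarrow> real" where
  "tail_rho n k = 1 / mu q n + rho q n - rho q k"

lemma tail_rho_pos: "k \<le> n \<Longrightarrow> tail_rho n k > 0"
  using rho_mono[of k n] divide_pos_pos[OF zero_less_one mu_pos[of n]] unfolding tail_rho_def by linarith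

text \<open>Divided by \<open>mu q k\<close>, the one-step growth of the reciprocal survival
  probability is at least the increment of \<open>rho\<close> over \<open>4 * c * (1 + M)\<close>.
  Summation back from generation \<open>k + l\<close> starts at \<open>1 / mu q (k + l)\<close>, the
  first part of \<open>tail_rho\<close>.\<close>

lemma surv_upper:
  assumes M: "\<And>i. 1 \<le> i \<Longrightarrow> i \<le> k + l \<Longrightarrow> f1 q i \<le> M" and "M \<ge> 0"
  shows "tail_rho (k + l) k / (4 * c * (1 + M)) \<le> 1 / (mu q k * surv l k)"
  using M
proof (induction l arbitrary: k)
  case 0
  have "1 * 1 \<le> (4 * c) * (1 + M)" using c_ge_1 \<open>M \<ge> 0\<close> by (intro mult_mono) auto
  then have "(1 / mu q k) / (4 * c * (1 + M)) \<le> (1 / mu q k) / 1"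
    using mu_pos[of k] by (intro divide_left_mono) auto
  then show ?case by (simp add: tail_rho_def)
next
  case (Suc l)
  let ?m = "f1 q (Suc k)" and ?s = "f2 q (Suc k)" and ?p = "surv l (Suc k)" and ?\<pi> = "surv (Suc l) k"
  interpret thinned_offspring "q (Suc k)" ?m ?s "enn2real (pgf_deriv 3 (q (Suc k)) 1)" c ?p ?\<pi>
    by (rule thinned)
  have "rho q (Suc k) - rho q k = ?s / (?m * mu q (Suc k))"
    by (simp add: rho_Suc)
  then have "(rho q (Suc k) - rho q k) / (4 * c * (1 + M)) = ?s / (?m * mu q (Suc k)) / (4 * c * (1 + M))"
    by simp
  also have "\<dots> \<le> ?s / (?m * mu q (Suc k)) / (4 * c * (1 + ?m))"
  proof (rule divide_left_mono)
    show "4 * c * (1 + ?m) \<le> 4 * c * (1 + M)"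
      using Suc.prems[of "Suc k"] c_ge_1 by (intro mult_left_mono) auto
  qed (use s_pos m_pos mu_pos[of "Suc k"] c_ge_1 \<open>M \<ge> 0\<close> in auto)
  also have "\<dots> = (1 / mu q k) * (?s / (4 * c * (1 + ?m) * ?m\<^sup>2))"
    by (simp add: mu_Suc power2_eq_square)
  also have "\<dots> \<le> (1 / mu q k) * (1 / ?\<pi> - 1 / (?m * ?p))"
    using mu_pos[of k] by (intro mult_left_mono inverse_survival_growth) auto
  also have "\<dots> = 1 / (mu q k * ?\<pi>) - 1 / (mu q (Suc k) * ?p)"
    by (simp add: mu_Suc right_diff_distrib)
  finally have 1: "(rho q (Suc k) - rho q k) / (4 * c * (1 + M)) + 1 / (mu q (Suc k) * ?p) \<le> 1 / (mu q k * ?\<pi>)"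
    by linarith
  have "tail_rho (Suc k + l) (Suc k) / (4 * c * (1 + M)) \<le> 1 / (mu q (Suc k) * ?p)"
    by (rule Suc.IH) (use Suc.prems in simp)
  moreover have "tail_rho (k + Suc l) k / (4 * c * (1 + M)) =
      (rho q (Suc k) - rho q k) / (4 * c * (1 + M)) + tail_rho (Suc k + l) (Suc k) / (4 * c * (1 + M))"
    by (simp add: tail_rho_def flip: add_divide_distrib)
  ultimately show ?case using 1 by linarith
qed

lemma surv_le:
  assumes M: "\<And>i. 1 \<le> i \<Longrightarrow> i \<le> k + l \<Longrightarrow> f1 q i \<le> M" and "M \<ge> 0"
  shows "surv l k \<le> 4 * c * (1 + M) / (mu q k * tail_rho (k + l) k)"
proof -
  have K: "4 * c * (1 + M) > 0" using c_ge_1 \<open>M \<ge> 0\<close> by simp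
  have *: "T / K \<le> 1 / (m * s) \<Longrightarrow> s \<le> K / (m * T)" if "T > 0" "K > 0" "m > 0" "s > 0" for T K m s :: real
    using that by (simp add: field_simps)
  show ?thesis
  proof (rule *[OF _ K mu_pos surv_pos])
    show "tail_rho (k + l) k / (4 * c * (1 + M)) \<le> 1 / (mu q k * surv l k)"
      by (rule surv_upper[OF assms])
  qed (simp add: tail_rho_pos)
qed

text \<open>The minimum combines two bounds for an increment of \<open>rho\<close> times a survival
  probability: the increment alone, at most a multiple of \<open>1 / mu q i\<close>, and the bound
  through \<open>surv_le\<close>.\<close>

definition weighted_sum :: "nat \<Rightarrow> nat \<Rightarrow> real" where
  "weighted_sum k n = (\<Sum>i = Suc k..n. 1 / mu q i * min 1 ((rho q i - rho q (i - 1)) / tail_rho n i))"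

lemma stein_error_le:
  assumes M: "\<And>i. 1 \<le> i \<Longrightarrow> i \<le> k + l \<Longrightarrow> f1 q i \<le> M" and "M \<ge> 0"
  shows "stein_error l k \<le> 40 * c\<^sup>2 * (1 + M)\<^sup>2 * mu q (k + l) * weighted_sum k (k + l)"
  using M
proof (induction l arbitrary: k)
  case (Suc l)
  let ?n = "k + Suc l"
  let ?m = "f1 q (Suc k)" and ?s = "f2 q (Suc k)" and ?p = "surv l (Suc k)" and ?\<mu> = "mu q (Suc k)"
  let ?d = "rho q (Suc k) - rho q k" and ?D = "tail_rho ?n (Suc k)"
  note pos = mu_pos[of "Suc k"] mu_pos[of ?n] surv_pos[of l "Suc k"] f1_pos[of "Suc k"] f2_pos[of "Suc k"]
    tail_rho_pos[of "Suc k" ?n] rho_increment_pos[of k]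
  have mM: "1 + ?m \<le> 1 + M" using Suc.prems[of "Suc k"] by simp
  have d: "?d = ?s / (?m * ?\<mu>)" by (simp add: rho_Suc)
  have "?s / ?m \<le> 4 * c * (1 + ?m)"
    using f2_le[of "Suc k"] pos by (simp add: pos_divide_le_eq)
  also have "\<dots> \<le> 4 * c * (1 + M)"
    using mM c_ge_1 by (intro mult_left_mono) auto
  finally have "?s / ?m / ?\<mu> \<le> 4 * c * (1 + M) / ?\<mu>"
    using pos by (intro divide_right_mono) auto
  then have d_le: "?d \<le> 4 * c * (1 + M) / ?\<mu>" by (simp add: d)
  have "?d * ?p \<le> 4 * c * (1 + M) / ?\<mu> * 1"
    using d_le pos surv_le_1[of l "Suc k"] c_ge_1 \<open>M \<ge> 0\<close> by (intro mult_mono) auto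
  moreover have "?d * ?p \<le> ?d * (4 * c * (1 + M) / (?\<mu> * ?D))"
    using surv_le[of "Suc k" l M] Suc.prems \<open>M \<ge> 0\<close> pos by (intro mult_left_mono) auto
  ultimately have dp: "?d * ?p \<le> 4 * c * (1 + M) / ?\<mu> * min 1 (?d / ?D)"
    by (auto simp: min_def mult.commute)
  \<comment> \<open>One factor \<open>?p\<close> cancels against the denominator of
    \<open>alive_mean\<close>; second moment, mean and \<open>?\<mu>\<close> combine to the
    increment \<open>?d\<close>.\<close>
  have "alive_mean l (Suc k) * (10 * c * (1 + ?m) * ?s * ?p\<^sup>2 / ?m) = 10 * c * mu q ?n * (1 + ?m) * (?d * ?p)"
    using pos by (simp add: alive_mean_def d power2_eq_square ac_simps)
  also have "\<dots> \<le> 10 * c * mu q ?n * (1 + M) * (4 * c * (1 + M) / ?\<mu> * min 1 (?d / ?D))"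
  proof (rule mult_mono[OF _ dp])
    show "10 * c * mu q ?n * (1 + ?m) \<le> 10 * c * mu q ?n * (1 + M)"
      using pos c_ge_1 mM by (intro mult_left_mono) auto
  qed (use pos c_ge_1 \<open>M \<ge> 0\<close> in auto)
  also have "\<dots> = 40 * c\<^sup>2 * (1 + M)\<^sup>2 * mu q ?n * (1 / ?\<mu> * min 1 (?d / ?D))"
    by (simp add: power2_eq_square)
  finally have "stein_error (Suc l) k \<le> 40 * c\<^sup>2 * (1 + M)\<^sup>2 * mu q ?n * weighted_sum (Suc k) ?n
      + 40 * c\<^sup>2 * (1 + M)\<^sup>2 * mu q ?n * (1 / ?\<mu> * min 1 (?d / ?D))"
    using Suc.IH[of "Suc k"] Suc.prems by simp
  also have "\<dots> = 40 * c\<^sup>2 * (1 + M)\<^sup>2 * mu q ?n * weighted_sum k ?n"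
  proof -
    have "weighted_sum k ?n = 1 / ?\<mu> * min 1 (?d / ?D) + weighted_sum (Suc k) ?n"
      unfolding weighted_sum_def by (subst sum.atLeast_Suc_atMost) (simp_all del: sum.cl_ivl_Suc)
    then show ?thesis by (simp only: distrib_left)
  qed
  finally show ?case .
qed (simp add: weighted_sum_def)

text \<open>The Stein bound is divided by \<open>alive_mean n 0\<close>, whose reciprocal is
  \<open>surv n 0 / mu q n\<close>. As \<open>rho q 0 = 0\<close>, \<open>tail_rho n 0\<close> is at
  least \<open>rho q n\<close>, and \<open>surv_le\<close> supplies the prefactor.\<close>

lemma wasserstein_le:
  assumes gw: "gwve P q \<xi>" and n: "n \<ge> 1" and M: "\<And>i. 1 \<le> i \<Longrightarrow> i \<le> n \<Longrightarrow> f1 q i \<le> M"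
  shows "wasserstein (yaglom_law P \<xi> n) std_exponential \<le>
    ereal (4 * c * (1 + M) / (mu q n * rho q n) * (2 + 160 * c\<^sup>2 * (1 + M)\<^sup>2 * mu q n * weighted_sum 0 n))"
proof -
  have M0: "M \<ge> 0" using M[of 1] f1_pos[of 1] n by simp
  interpret gwve P q \<xi> by (rule gw)
  have pos: "measure (gw_law q n 0) {0<..} > 0"
    using surv_pos[of n 0] by (simp add: surv_def)
  have mean: "cond_mean P \<xi> n = alive_mean n 0"
    using yaglom_law_eq(1)[OF pos] alive_moments(2)[of n 0] by (simp add: alive_def)
  have law: "yaglom_law P \<xi> n = distr (alive n 0) borel (\<lambda>x. real x / alive_mean n 0)"
    using yaglom_law_eq(2)[OF pos] by (simp add: mean alive_def)
  have "tail_rho n 0 \<ge> rho q n"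
    using mu_pos[of n] by (simp add: tail_rho_def) (simp add: rho_def)
  have "surv n 0 \<le> 4 * c * (1 + M) / (mu q 0 * tail_rho (0 + n) 0)"
    by (rule surv_le) (use M M0 in auto)
  also have "\<dots> \<le> 4 * c * (1 + M) / rho q n"
    using \<open>tail_rho n 0 \<ge> rho q n\<close> rho_pos[OF n] c_ge_1 M0
    by (simp add: mu_def) (intro divide_left_mono, auto)
  finally have surv: "surv n 0 \<le> 4 * c * (1 + M) / rho q n" .
  have err: "4 * stein_error n 0 + 2 \<le> 2 + 160 * c\<^sup>2 * (1 + M)\<^sup>2 * mu q n * weighted_sum 0 n"
  proof -
    have *: "E \<le> 40 * X \<Longrightarrow> 4 * E + 2 \<le> 2 + 160 * X" for E X :: real by simp
    show ?thesis using stein_error_le[of 0 n M] M M0 by (simp only: mult.assoc) (rule *, simp)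
  qed
  have ws: "weighted_sum 0 n \<ge> 0"
    unfolding weighted_sum_def
  proof (intro sum_nonneg mult_nonneg_nonneg)
    fix i assume "i \<in> {Suc 0..n}"
    then show "0 \<le> min 1 ((rho q i - rho q (i - 1)) / tail_rho n i)"
      using rho_mono[of "i - 1" i] tail_rho_pos[of i n] by simp
  qed (use mu_pos less_imp_le in auto)
  have "(4 * stein_error n 0 + 2) / alive_mean n 0 = surv n 0 / mu q n * (4 * stein_error n 0 + 2)"
    by (simp add: alive_mean_def mu_def)
  also have "\<dots> \<le> surv n 0 / mu q n * (2 + 160 * c\<^sup>2 * (1 + M)\<^sup>2 * mu q n * weighted_sum 0 n)"
    using surv_pos[of n 0] mu_pos[of n] err by (intro mult_left_mono) auto
  also have "\<dots> \<le> 4 * c * (1 + M) / rho q n / mu q n * (2 + 160 * c\<^sup>2 * (1 + M)\<^sup>2 * mu q n * weighted_sum 0 n)"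
    using surv ws mu_pos[of n] by (intro mult_right_mono divide_right_mono) (auto intro!: add_nonneg_nonneg)
  finally have le: "(4 * stein_error n 0 + 2) / alive_mean n 0 \<le>
      4 * c * (1 + M) / (mu q n * rho q n) * (2 + 160 * c\<^sup>2 * (1 + M)\<^sup>2 * mu q n * weighted_sum 0 n)"
    by (simp add: mult.commute)
  show ?thesis
    unfolding wasserstein_def
  proof (rule SUP_least)
    fix h :: "real \<Rightarrow> real" assume "h \<in> {f. 1-lipschitz_on UNIV f}"
    then have lip: "1-lipschitz_on UNIV h" by simp
    then have [measurable]: "h \<in> borel_measurable borel"
      by (intro borel_measurable_continuous_onI lipschitz_on_continuous_on)
    have "\<bar>(\<integral>x. h x \<partial>yaglom_law P \<xi> n) - (\<integral>x. h x \<partial>std_exponential)\<bar> =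
        \<bar>(\<integral>x. h (real x / alive_mean n 0) \<partial>alive n 0) - (\<integral>x. h x \<partial>std_exponential)\<bar>"
      unfolding law by (subst integral_distr) auto
    also have "\<dots> \<le> (4 * stein_error n 0 + 2) / alive_mean n 0"
      by (rule stein_bound_lipschitz[OF alive_moments(3) alive_pos[OF surv_pos] alive_mean_pos alive_moments(1) lip])
    also note le
    finally show "ereal \<bar>(\<integral>x. h x \<partial>yaglom_law P \<xi> n) - (\<integral>x. h x \<partial>std_exponential)\<bar> \<le>
        ereal (4 * c * (1 + M) / (mu q n * rho q n) * (2 + 160 * c\<^sup>2 * (1 + M)\<^sup>2 * mu q n * weighted_sum 0 n))"
      by simp
  qed
qed

end


section \<open>The convergence rate\<close>

lemma min_1_le_ln:
  fixes x :: real
  assumes "x \<ge> 0"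
  shows "min 1 x \<le> 2 * ln (1 + x)"
proof -
  have "min 1 x \<le> 2 * (1 - 1 / (1 + x))"
    using assms by (cases "x \<le> 1") (auto simp: field_simps mult_left_le)
  also have "1 - 1 / (1 + x) \<le> ln (1 + x)"
    using ln_le_minus_one[of "1 / (1 + x)"] assms by (simp add: ln_div)
  finally show ?thesis by simp
qed

section \<open>Summation by parts with step two\<close>

context environment
begin

abbreviation w :: "nat \<Rightarrow> real" where
  "w k \<equiv> 1 / mu q k"

abbreviation log_ratio :: "nat \<Rightarrow> nat \<Rightarrow> real" where
  "log_ratio n i \<equiv> ln (tail_rho n (i - 1) / tail_rho n i)"

lemma w_pos: "w k > 0"
  by (simp add: mu_pos)

lemma sum_log_ratio:
  assumes "j \<le> n"
  shows "(\<Sum>i = 1..j. log_ratio n i) = ln (tail_rho n 0 / tail_rho n j)"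
  using assms
proof (induction j)
  case (Suc j)
  then show ?case using tail_rho_pos[of 0 n] tail_rho_pos[of j n] tail_rho_pos[of "Suc j" n]
    by (simp add: ln_div)
qed (use tail_rho_pos[of 0 n] in simp)

lemma log_ratio_nonneg: "i \<le> n \<Longrightarrow> log_ratio n i \<ge> 0"
  using tail_rho_pos[of i n] rho_mono[of "i - 1" i]
  by (intro ln_ge_zero) (simp add: tail_rho_def)

text \<open>The telescoped quotient grows when the total \<open>1 / mu q n + rho q n\<close> is
  lowered to \<open>rho q k\<close>, which makes the bound independent of \<open>n\<close>. The last
  increment of \<open>rho\<close>, at least \<open>a / (f1 q k * mu q k)\<close>, bounds the
  denominator from below.\<close>

lemma sum_log_ratio_le:
  assumes "2 \<le> k" "k \<le> n"
  shows "(\<Sum>i = 1..k - 2. log_ratio n i) \<le> ln (f1 q k * mu q k * rho q k / a)"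
proof -
  obtain j where k: "k = Suc (Suc j)" using assms(1) by (metis add_2_eq_Suc le_Suc_ex)
  note pos = tail_rho_pos[of 0 n] tail_rho_pos[of j n] rho_pos[of k] f1_pos[of k] mu_pos[of k] mu_pos[of n] a_pos
    rho_nonneg[of j] rho_mono[of j "Suc j"] rho_increment_pos[of "Suc j"] rho_mono[of k n]
  have inc: "rho q k - rho q j \<ge> a / (f1 q k * mu q k)"
  proof -
    have "a / (f1 q k * mu q k) \<le> f2 q k / (f1 q k * mu q k)"
      using pos f2_ge[of k] by (intro divide_right_mono) (auto simp: k)
    also have "\<dots> = rho q k - rho q (Suc j)" by (simp add: rho_Suc k)
    finally show ?thesis using pos by linarith
  qed
  have y: "rho q k \<le> 1 / mu q n + rho q n"
    using pos assms(2) divide_pos_pos[OF zero_less_one mu_pos[of n]] by linarith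
  have "tail_rho n 0 / tail_rho n j \<le> rho q k / (rho q k - rho q j)"
  proof -
    have *: "y / (y - r) \<le> x / (x - r)" if "0 \<le> r" "r < x" "x \<le> y" for x y r :: real
    proof -
      have "r * x \<le> r * y" using that by (intro mult_left_mono)
      then show ?thesis using that by (simp add: field_simps)
    qed
    show ?thesis
      using *[of "rho q j" "rho q k" "1 / mu q n + rho q n"] y pos by (simp add: tail_rho_def k rho_def[of q 0])
  qed
  also have "\<dots> \<le> rho q k / (a / (f1 q k * mu q k))"
    using inc pos assms by (intro divide_left_mono) (auto simp: k)
  also have "\<dots> = f1 q k * mu q k * rho q k / a"
    using pos assms by (simp add: field_simps)
  finally have "ln (tail_rho n 0 / tail_rho n j) \<le> ln (f1 q k * mu q k * rho q k / a)"
    using pos assms by (subst ln_le_cancel_iff) (auto simp: k)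
  then show ?thesis using sum_log_ratio[of j n] assms by (simp add: k)
qed

text \<open>Steps of two lead from \<open>k\<close> to \<open>n - 2\<close> or to
  \<open>n - 1\<close>, depending on parity; both end values are added to cover either case.\<close>

lemma w_le_variation:
  assumes "k + 2 \<le> n"
  shows "w k \<le> w (n - 2) + w (n - 1) + (\<Sum>j = k + 2..n - 1. \<bar>w (j - 2) - w j\<bar>)"
  using assms
proof (induction "n - k" arbitrary: k rule: less_induct)
  case less
  consider "k = n - 2" | "k = n - 3" "n \<ge> 3" | "k + 4 \<le> n" using less.prems by linarith
  then show ?case
  proof cases
    case 1
    then show ?thesis using w_pos[of "n - 1"] less.prems by (auto intro: less_imp_le)
  next
    case 2
    then have e: "k + 2 = n - 1" by simp
    then have "(\<Sum>j = k + 2..n - 1. \<bar>w (j - 2) - w j\<bar>) = \<bar>w k - w (n - 1)\<bar>"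
      unfolding e[symmetric] by simp
    then show ?thesis using w_pos[of "n - 2"] by linarith
  next
    case 3
    \<comment> \<open>The term with index \<open>k + 3\<close> belongs to the other parity class and
      is dropped.\<close>
    have "(\<Sum>j = k + 2..n - 1. \<bar>w (j - 2) - w j\<bar>) \<ge> \<bar>w k - w (k + 2)\<bar> + (\<Sum>j = k + 4..n - 1. \<bar>w (j - 2) - w j\<bar>)"
    proof -
      have "(\<Sum>j = k + 2..n - 1. \<bar>w (j - 2) - w j\<bar>) \<ge> (\<Sum>j \<in> insert (k + 2) {k + 4..n - 1}. \<bar>w (j - 2) - w j\<bar>)"
        using 3 by (intro sum_mono2) auto
      then show ?thesis by simp
    qed
    moreover have e: "k + 2 + 2 = k + 4" by simp
    have "w (k + 2) \<le> w (n - 2) + w (n - 1) + (\<Sum>j = k + 4..n - 1. \<bar>w (j - 2) - w j\<bar>)"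
      by (rule less.hyps[of "k + 2", unfolded e]) (use 3 in auto)
    ultimately show ?thesis by linarith
  qed
qed

text \<open>Each weight is replaced by its variation bound and the order of summation is exchanged
  over \<open>i + 2 \<le> j\<close>. The inner sums then end at \<open>j - 2\<close>, as in
  \<open>sum_log_ratio_le\<close>.\<close>

lemma weighted_log_sum_le:
  assumes "n \<ge> 3"
  shows "(\<Sum>i = 1..n - 2. w i * log_ratio n i) \<le> (w (n - 2) + w (n - 1)) * (\<Sum>i = 1..n - 2. log_ratio n i)
     + (\<Sum>j = 3..n - 1. \<bar>w (j - 2) - w j\<bar> * (\<Sum>i = 1..j - 2. log_ratio n i))"
proof -
  have "(\<Sum>i = 1..n - 2. w i * log_ratio n i) \<le>
     (\<Sum>i = 1..n - 2. (w (n - 2) + w (n - 1) + (\<Sum>j = i + 2..n - 1. \<bar>w (j - 2) - w j\<bar>)) * log_ratio n i)"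
    by (intro sum_mono mult_right_mono w_le_variation log_ratio_nonneg) (use assms in auto)
  also have "\<dots> = (w (n - 2) + w (n - 1)) * (\<Sum>i = 1..n - 2. log_ratio n i) +
     (\<Sum>i = 1..n - 2. \<Sum>j = i + 2..n - 1. \<bar>w (j - 2) - w j\<bar> * log_ratio n i)"
    by (simp only: distrib_right[of "w (n - 2) + w (n - 1)"] sum.distrib sum_distrib_left sum_distrib_right)
  also have "(\<Sum>i = 1..n - 2. \<Sum>j = i + 2..n - 1. \<bar>w (j - 2) - w j\<bar> * log_ratio n i) =
     (\<Sum>i = 1..n - 2. \<Sum>j | j \<in> {3..n - 1} \<and> i + 2 \<le> j. \<bar>w (j - 2) - w j\<bar> * log_ratio n i)"
    by (intro sum.cong refl) auto
  also have "\<dots> = (\<Sum>j = 3..n - 1. \<Sum>i | i \<in> {1..n - 2} \<and> i + 2 \<le> j. \<bar>w (j - 2) - w j\<bar> * log_ratio n i)"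
    by (rule sum.swap_restrict) auto
  also have "\<dots> = (\<Sum>j = 3..n - 1. \<bar>w (j - 2) - w j\<bar> * (\<Sum>i = 1..j - 2. log_ratio n i))"
    unfolding sum_distrib_left by (intro sum.cong refl) auto
  finally show ?thesis .
qed

text \<open>The last two terms are bounded by their weights, as \<open>w_le_variation\<close>
  reaches only up to \<open>n - 2\<close>. In the others, 1 plus the quotient is the ratio of
  consecutive values of \<open>tail_rho\<close>, so \<open>min_1_le_ln\<close> applies.\<close>

lemma weighted_sum_le:
  assumes n: "n \<ge> 3"
  shows "weighted_sum 0 n \<le> w n + w (n - 1) + 2 * (\<Sum>i = 1..n - 2. w i * log_ratio n i)"
proof -
  let ?t = "\<lambda>i. w i * min 1 ((rho q i - rho q (i - 1)) / tail_rho n i)"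
  have "{Suc 0..n} = {1..n - 2} \<union> {n - 1, n}" using n by auto
  then have "weighted_sum 0 n = (\<Sum>i = 1..n - 2. ?t i) + (?t (n - 1) + ?t n)"
  proof -
    assume *: "{Suc 0..n} = {1..n - 2} \<union> {n - 1, n}"
    show ?thesis
      unfolding weighted_sum_def * by (subst sum.union_disjoint) (use n in auto)
  qed
  moreover have "?t i \<le> w i" for i
    using w_pos[of i] by (intro mult_left_le) auto
  moreover have "(\<Sum>i = 1..n - 2. ?t i) \<le> (\<Sum>i = 1..n - 2. 2 * (w i * log_ratio n i))"
  proof (rule sum_mono)
    fix i assume i: "i \<in> {1..n - 2}"
    let ?x = "(rho q i - rho q (i - 1)) / tail_rho n i"
    have D: "tail_rho n i > 0" by (rule tail_rho_pos) (use i in auto)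
    then have "tail_rho n (i - 1) / tail_rho n i = 1 + ?x"
      by (simp add: field_simps) (simp add: tail_rho_def)
    moreover have "?x \<ge> 0" using D rho_mono[of "i - 1" i] by simp
    ultimately have "min 1 ?x \<le> 2 * log_ratio n i"
      using min_1_le_ln by metis
    then have "w i * min 1 ?x \<le> w i * (2 * log_ratio n i)"
      using w_pos[of i] by (intro mult_left_mono) auto
    then show "?t i \<le> 2 * (w i * log_ratio n i)" by simp
  qed
  ultimately show ?thesis
    unfolding sum_distrib_left[symmetric] by (smt (verit))
qed

text \<open>A small mean would force a small second moment through \<open>f2_le\<close>, against
  \<open>f2_ge\<close>.\<close>

lemma f1_lower: "n \<ge> 1 \<Longrightarrow> f1 q n \<ge> min 1 (a / (8 * c))"
proof (rule ccontr)
  assume n: "n \<ge> 1" and "\<not> f1 q n \<ge> min 1 (a / (8 * c))"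
  then have lt: "f1 q n < 1" "f1 q n < a / (8 * c)" by auto
  have "a \<le> 4 * c * (1 + f1 q n) * f1 q n" using f2_le[OF n] f2_ge[OF n] by simp
  also have "\<dots> \<le> 4 * c * 2 * f1 q n"
    using lt c_ge_1 f1_pos[OF n] by (intro mult_right_mono mult_left_mono) auto
  also have "\<dots> < a" using lt c_ge_1 by (simp add: field_simps)
  finally show False by simp
qed

end


section \<open>From the weighted sum to the rate\<close>

context environment
begin

lemma f1_le_sup_mean: "1 \<le> i \<Longrightarrow> i \<le> n \<Longrightarrow> f1 q i \<le> sup_mean q n"
  unfolding sup_mean_def by (rule cSUP_upper) auto

lemma sup_mean_pos: "n \<ge> 1 \<Longrightarrow> sup_mean q n > 0"
  using f1_le_sup_mean[of 1 n] f1_pos[of 1] by simp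

lemma s_seq_nonneg: "s_seq q n \<ge> 0"
  unfolding s_seq_def by (intro sum_nonneg) auto

text \<open>\<open>f1_lower\<close> keeps \<open>ln (f1 q k)\<close> bounded below, so the
  divergence of \<open>mu q k * rho q k\<close> carries over.\<close>

lemma log_term_at_top:
  assumes "filterlim (\<lambda>n. mu q n * rho q n) at_top sequentially"
  shows "\<exists>k0\<ge>3. \<forall>k\<ge>k0. log_term q k \<ge> 1"
proof -
  let ?\<delta> = "min 1 (a / (8 * c))"
  have \<delta>: "?\<delta> > 0" using a_pos c_ge_1 by simp
  have "\<forall>\<^sub>F n in sequentially. exp (1 - ln ?\<delta>) \<le> mu q n * rho q n"
    using assms by (simp only: filterlim_at_top)
  then obtain N where N: "\<And>n. n \<ge> N \<Longrightarrow> exp (1 - ln ?\<delta>) \<le> mu q n * rho q n"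
    by (auto simp: eventually_sequentially)
  have "log_term q k \<ge> 1" if "k \<ge> max 3 N" for k
  proof -
    have "ln (exp (1 - ln ?\<delta>)) \<le> ln (mu q k * rho q k)"
      using N[of k] that by (subst ln_le_cancel_iff) (auto intro: less_le_trans[OF exp_gt_zero])
    moreover have "ln ?\<delta> \<le> ln (f1 q k)"
      using f1_lower[of k] \<delta> that f1_pos[of k] by (subst ln_le_cancel_iff) auto
    ultimately show ?thesis by (simp add: log_term_def mult.commute)
  qed
  then show ?thesis by (intro exI[of _ "max 3 N"]) auto
qed

lemma ln_div_a_eq: "k \<ge> 1 \<Longrightarrow> ln (f1 q k * mu q k * rho q k / a) = log_term q k - ln a"
  using f1_pos[of k] mu_pos[of k] rho_pos[of k] a_pos
  by (simp add: log_term_def ln_mult ln_div)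

lemma ln_div_a_le:
  assumes "k \<ge> 1" "log_term q k \<ge> 1"
  shows "ln (f1 q k * mu q k * rho q k / a) \<le> (1 + \<bar>ln a\<bar>) * log_term q k"
proof -
  have "- ln a \<le> \<bar>ln a\<bar> * log_term q k"
    using assms mult_left_mono[of 1 "log_term q k" "\<bar>ln a\<bar>"] by simp
  then show ?thesis using assms by (simp add: ln_div_a_eq distrib_right)
qed

text \<open>Beyond \<open>k0\<close> the logarithmic weights are at least 1 and absorb constants.
  The part up to \<open>k0\<close> is a number \<open>K\<close> independent of \<open>n\<close>.
  Started at \<open>k0\<close>, \<open>w_le_variation\<close> bounds the fixed positive number
  \<open>w k0\<close> by the claimed expression, and hence also its multiple
  \<open>K\<close>.\<close>

lemma weighted_sum_asymptotic:
  assumes k0: "k0 \<ge> 3" "\<And>k. k \<ge> k0 \<Longrightarrow> log_term q k \<ge> 1"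
  shows "\<exists>C\<ge>0. \<forall>n\<ge>k0 + 2. weighted_sum 0 n \<le> C * (1 + sup_mean q n)\<^sup>2 * (w n * log_term q n + s_seq q n)"
proof -
  define v where "v j = \<bar>w (j - 2) - w j\<bar>" for j
  define \<kappa> where "\<kappa> = 1 + \<bar>ln a\<bar>"
  define g where "g j = v j * \<bar>ln (f1 q j * mu q j * rho q j / a)\<bar>" for j
  define K where "K = (\<Sum>j = 3..k0. g j)"
  have v_nonneg: "v j \<ge> 0" for j by (simp add: v_def)
  have K: "K \<ge> 0" unfolding K_def g_def by (intro sum_nonneg) (simp add: v_nonneg)
  have \<kappa>: "\<kappa> \<ge> 1" by (simp add: \<kappa>_def)
  have "weighted_sum 0 n \<le> (1 + 2 * \<kappa> + 2 * (K / w k0)) * (1 + sup_mean q n)\<^sup>2 * (w n * log_term q n + s_seq q n)"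
    if n: "n \<ge> k0 + 2" for n
  proof -
    define M where "M = sup_mean q n"
    define L where "L = log_term q n"
    define s where "s = s_seq q n"
    define R where "R = w n * L + s"
    have n3: "n \<ge> 3" using n k0(1) by simp
    have M: "M > 0" unfolding M_def by (rule sup_mean_pos) (use n in simp)
    have L: "L \<ge> 1" unfolding L_def by (rule k0) (use n in simp)
    have s: "s \<ge> 0" unfolding s_def by (rule s_seq_nonneg)
    have wL: "w n \<le> w n * L" using mult_left_mono[OF L, of "w n"] w_pos[of n] by simp
    have M2: "1 \<le> (1 + M)\<^sup>2" using M by (simp add: one_le_power)
    have w1: "w (n - 1) = f1 q n * w n"
      using mu_Suc[of "n - 1"] mu_pos[of n] f1_pos[of n] n by simp
    have w2: "w (n - 2) = f1 q (n - 1) * w (n - 1)"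
    proof -
      have "Suc (n - 2) = n - 1" using n by simp
      then show ?thesis using mu_Suc[of "n - 2"] mu_pos[of "n - 1"] f1_pos[of "n - 1"] n by simp
    qed
    have f1M: "f1 q n \<le> M" "f1 q (n - 1) \<le> M"
      unfolding M_def using n by (auto intro!: f1_le_sup_mean)
    have w1': "w (n - 1) \<le> M * w n"
      unfolding w1 using f1M w_pos[of n] by (intro mult_right_mono) auto
    have "w (n - 2) \<le> M * (M * w n)"
      unfolding w2 using f1M w1' M w_pos[of "n - 1"] by (intro mult_mono) auto
    \<comment> \<open>One generation back multiplies \<open>w\<close> by an offspring mean of at
      most \<open>M\<close>; two such steps from \<open>n\<close> account for
      \<open>(1 + M)\<^sup>2\<close>.\<close>
    with w1' have w12: "w (n - 2) + w (n - 1) \<le> (1 + M)\<^sup>2 * w n"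
    proof -
      assume "w (n - 1) \<le> M * w n" "w (n - 2) \<le> M * (M * w n)"
      moreover have "(1 + M)\<^sup>2 * w n = w n + 2 * (M * w n) + M * (M * w n)"
        by (simp only: power2_eq_square distrib_left distrib_right)
      moreover have "M * w n \<ge> 0" using M w_pos[of n] by simp
      ultimately show ?thesis using w_pos[of n] by linarith
    qed
    have R: "R \<ge> 0" using s wL w_pos[of n] unfolding R_def by linarith
    have R_ge: "(1 + M)\<^sup>2 * (w n * L) + s \<le> (1 + M)\<^sup>2 * R"
      using mult_right_mono[OF M2 s] by (simp add: R_def distrib_left)
    have first: "w n + w (n - 1) \<le> (1 + M)\<^sup>2 * R"
    proof -
      have "w n + w (n - 1) \<le> (1 + M) * w n" using w1' by (simp only: distrib_right)
      also have "\<dots> \<le> (1 + M)\<^sup>2 * (w n * L)"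
        using wL M w_pos[of n] self_le_power[of "1 + M" 2] by (intro mult_mono) auto
      finally show ?thesis using R_ge s by linarith
    qed
    have H_le: "(\<Sum>i = 1..n - 2. log_ratio n i) \<le> \<kappa> * L"
      unfolding L_def \<kappa>_def
      by (rule order_trans[OF sum_log_ratio_le ln_div_a_le]) (use L n L_def in auto)
    have v_sum: "(\<Sum>j = k0 + 2..n - 1. v j) \<le> s"
    proof -
      have "(\<Sum>j = k0 + 2..n - 1. v j) \<le> (\<Sum>j = k0 + 2..n - 1. max 0 (log_term q j) * v j)"
      proof (rule sum_mono)
        fix j assume "j \<in> {k0 + 2..n - 1}"
        then have "1 \<le> max 0 (log_term q j)" using k0(2)[of j] by simp
        from mult_right_mono[OF this v_nonneg[of j]] show "v j \<le> max 0 (log_term q j) * v j" by simp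
      qed
      also have "\<dots> \<le> s"
        unfolding s_def s_seq_def v_def using n by (intro sum_mono2) auto
      finally show ?thesis .
    qed
    have "w k0 \<le> (1 + M)\<^sup>2 * R"
    proof -
      have "w k0 \<le> w (n - 2) + w (n - 1) + (\<Sum>j = k0 + 2..n - 1. v j)"
        unfolding v_def by (rule w_le_variation) (use n in simp)
      moreover have "(1 + M)\<^sup>2 * w n \<le> (1 + M)\<^sup>2 * (w n * L)"
        using wL by (intro mult_left_mono) auto
      ultimately show ?thesis using w12 v_sum R_ge by linarith
    qed
    then have "K / w k0 * w k0 \<le> K / w k0 * ((1 + M)\<^sup>2 * R)"
      using K w_pos[of k0] by (intro mult_left_mono) auto
    then have K_le: "K \<le> K / w k0 * ((1 + M)\<^sup>2 * R)"
      using w_pos[of k0] mu_pos[of k0] by simp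
    have S_le: "(\<Sum>j = 3..n - 1. v j * (\<Sum>i = 1..j - 2. log_ratio n i)) \<le> K + \<kappa> * s"
    proof -
      \<comment> \<open>Indices up to \<open>k0\<close> are charged to \<open>g\<close>, which does
        not depend on \<open>n\<close>; for later ones the logarithm is at most
        \<open>\<kappa> * log_term q j\<close>, and these terms add up within
        \<open>s\<close>.\<close>
      have "(\<Sum>j = 3..n - 1. v j * (\<Sum>i = 1..j - 2. log_ratio n i)) \<le>
          (\<Sum>j = 3..n - 1. (if j \<le> k0 then g j else 0) + \<kappa> * (max 0 (log_term q j) * v j))"
      proof (rule sum_mono)
        fix j assume j: "j \<in> {3..n - 1}"
        have le: "v j * (\<Sum>i = 1..j - 2. log_ratio n i) \<le> v j * ln (f1 q j * mu q j * rho q j / a)"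
          by (intro mult_left_mono sum_log_ratio_le v_nonneg) (use j in auto)
        show "v j * (\<Sum>i = 1..j - 2. log_ratio n i) \<le>
            (if j \<le> k0 then g j else 0) + \<kappa> * (max 0 (log_term q j) * v j)"
        proof (cases "j \<le> k0")
          case True
          have "v j * ln (f1 q j * mu q j * rho q j / a) \<le> g j"
            unfolding g_def by (intro mult_left_mono v_nonneg) auto
          moreover have "0 \<le> \<kappa> * (max 0 (log_term q j) * v j)"
            using \<kappa> v_nonneg by (intro mult_nonneg_nonneg) auto
          ultimately show ?thesis using le True by simp
        next
          case False
          then have Lj: "log_term q j \<ge> 1" by (intro k0) simp
          have "v j * ln (f1 q j * mu q j * rho q j / a) \<le> v j * (\<kappa> * log_term q j)"
            unfolding \<kappa>_def by (intro mult_left_mono ln_div_a_le v_nonneg Lj) (use j in auto)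
          also have "\<dots> = \<kappa> * (max 0 (log_term q j) * v j)" using Lj by simp
          finally show ?thesis using le False by simp
        qed
      qed
      also have "\<dots> = (\<Sum>j = 3..n - 1. if j \<le> k0 then g j else 0) + \<kappa> * (\<Sum>j = 3..n - 1. max 0 (log_term q j) * v j)"
        by (simp only: sum.distrib sum_distrib_left)
      also have "(\<Sum>j = 3..n - 1. if j \<le> k0 then g j else 0) = K"
        unfolding K_def using n by (intro sum.mono_neutral_cong_right) auto
      also have "(\<Sum>j = 3..n - 1. max 0 (log_term q j) * v j) \<le> s"
        unfolding s_def s_seq_def v_def by (intro sum_mono2) auto
      finally show ?thesis using \<kappa> by (simp add: mult_left_mono)
    qed
    have "(w (n - 2) + w (n - 1)) * (\<Sum>i = 1..n - 2. log_ratio n i) \<le> ((1 + M)\<^sup>2 * w n) * (\<kappa> * L)"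
    proof (rule mult_mono[OF w12 H_le])
      show "0 \<le> (1 + M)\<^sup>2 * w n" using w_pos[of n] by simp
      show "0 \<le> (\<Sum>i = 1..n - 2. log_ratio n i)" by (intro sum_nonneg log_ratio_nonneg) auto
    qed
    with weighted_log_sum_le[OF n3] S_le
    have "(\<Sum>i = 1..n - 2. w i * log_ratio n i) \<le> \<kappa> * ((1 + M)\<^sup>2 * (w n * L)) + (K + \<kappa> * s)"
      unfolding v_def by (simp add: ac_simps) 
    also have "\<dots> = \<kappa> * ((1 + M)\<^sup>2 * (w n * L) + s) + K" by (simp add: distrib_left)
    also have "\<dots> \<le> \<kappa> * ((1 + M)\<^sup>2 * R) + K / w k0 * ((1 + M)\<^sup>2 * R)"
      using R_ge \<kappa> K_le by (intro add_mono mult_left_mono) auto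
    finally have sum_le: "(\<Sum>i = 1..n - 2. w i * log_ratio n i) \<le> \<kappa> * ((1 + M)\<^sup>2 * R) + K / w k0 * ((1 + M)\<^sup>2 * R)" .
    have "W \<le> X + 2 * Y \<Longrightarrow> X \<le> X' \<Longrightarrow> Y \<le> Y' \<Longrightarrow> W \<le> X' + 2 * Y'" for W X X' Y Y' :: real
      by simp
    from this[OF weighted_sum_le[OF n3] first sum_le]
    have "weighted_sum 0 n \<le> (1 + M)\<^sup>2 * R + 2 * (\<kappa> * ((1 + M)\<^sup>2 * R) + K / w k0 * ((1 + M)\<^sup>2 * R))" .
    also have "\<dots> = (1 + 2 * \<kappa> + 2 * (K / w k0)) * (1 + M)\<^sup>2 * R"
      by (simp add: distrib_right distrib_left mult.assoc)
    finally show ?thesis by (simp only: R_def M_def L_def s_def)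
  qed
  moreover have "1 + 2 * \<kappa> + 2 * (K / w k0) \<ge> 0"
    using \<kappa> K w_pos[of k0] by simp
  ultimately show ?thesis by blast
qed

text \<open>The fifth power collects one factor \<open>1 + sup_mean q n\<close> from the survival
  probability, two from \<open>stein_error_le\<close> and two from
  \<open>weighted_sum_asymptotic\<close>. The finitely many earlier \<open>n\<close> with positive
  \<open>log_term\<close> are met by enlarging the constant.\<close>

lemma wasserstein_rate:
  assumes gw: "gwve P q \<xi>" and lim: "filterlim (\<lambda>n. mu q n * rho q n) at_top sequentially"
  shows "\<exists>C>0. \<forall>n\<ge>3. log_term q n > 0 \<longrightarrow> wasserstein (yaglom_law P \<xi> n) std_exponential
      \<le> ereal (C * (1 + sup_mean q n) ^ 5 * (log_term q n / (mu q n * rho q n) + s_seq q n / rho q n))"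
proof -
  define B where "B n = 4 * c * (1 + sup_mean q n) / (mu q n * rho q n) *
      (2 + 160 * c\<^sup>2 * (1 + sup_mean q n)\<^sup>2 * mu q n * weighted_sum 0 n)" for n
  define R where "R n = (1 + sup_mean q n) ^ 5 * (log_term q n / (mu q n * rho q n) + s_seq q n / rho q n)" for n
  obtain k0 where k0: "k0 \<ge> 3" "\<And>k. k \<ge> k0 \<Longrightarrow> log_term q k \<ge> 1"
    using log_term_at_top[OF lim] by blast
  obtain C1 where C1: "C1 \<ge> 0" "\<And>n. n \<ge> k0 + 2 \<Longrightarrow>
      weighted_sum 0 n \<le> C1 * (1 + sup_mean q n)\<^sup>2 * (w n * log_term q n + s_seq q n)"
    using weighted_sum_asymptotic[OF k0] by blast
  define C2 where "C2 = 4 * c * (2 + 160 * c\<^sup>2 * C1)"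
  have C2: "C2 > 0" unfolding C2_def using c_ge_1 C1 by (intro mult_pos_pos add_pos_nonneg) auto
  have large: "B n \<le> C2 * R n" if n: "n \<ge> k0 + 2" for n
  proof -
    let ?M = "sup_mean q n" and ?\<mu> = "mu q n" and ?L = "log_term q n"
    let ?R = "w n * ?L + s_seq q n"
    have M: "1 + ?M \<ge> 1" using sup_mean_pos[of n] n by simp
    have L: "?L \<ge> 1" by (rule k0) (use n in simp)
    have rho: "rho q n > 0" by (rule rho_pos) (use n in simp)
    note pos = M L rho mu_pos[of n] s_seq_nonneg[of n] c_ge_1
    \<comment> \<open>The summand 2 is absorbed because \<open>?\<mu> * ?R\<close> is at least
      \<open>?L\<close>, which is at least 1.\<close>
    have "2 * 1 \<le> 2 * ((1 + ?M) ^ 4 * (?\<mu> * ?R))"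
    proof (rule mult_left_mono)
      have "?\<mu> * (w n * ?L) \<le> ?\<mu> * ?R" using pos by (intro mult_left_mono) auto
      then have "1 \<le> ?\<mu> * ?R" using pos by simp
      then have "1 * 1 \<le> (1 + ?M) ^ 4 * (?\<mu> * ?R)"
        using M by (intro mult_mono one_le_power) auto
      then show "1 \<le> (1 + ?M) ^ 4 * (?\<mu> * ?R)" by simp
    qed simp
    moreover have "160 * c\<^sup>2 * (1 + ?M)\<^sup>2 * ?\<mu> * weighted_sum 0 n \<le>
        160 * c\<^sup>2 * (1 + ?M)\<^sup>2 * ?\<mu> * (C1 * (1 + ?M)\<^sup>2 * ?R)"
      using C1(2)[OF n] pos by (intro mult_left_mono) auto
    moreover have "160 * c\<^sup>2 * (1 + ?M)\<^sup>2 * ?\<mu> * (C1 * (1 + ?M)\<^sup>2 * ?R) = 160 * c\<^sup>2 * C1 * ((1 + ?M) ^ 4 * (?\<mu> * ?R))"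
      by (simp add: power4_eq_xxxx power2_eq_square)
    ultimately have "2 + 160 * c\<^sup>2 * (1 + ?M)\<^sup>2 * ?\<mu> * weighted_sum 0 n \<le>
        (2 + 160 * c\<^sup>2 * C1) * ((1 + ?M) ^ 4 * (?\<mu> * ?R))"
      by (simp only: distrib_right)
    then have "B n \<le> 4 * c * (1 + ?M) / (?\<mu> * rho q n) * ((2 + 160 * c\<^sup>2 * C1) * ((1 + ?M) ^ 4 * (?\<mu> * ?R)))"
      unfolding B_def using pos by (intro mult_left_mono divide_nonneg_nonneg mult_nonneg_nonneg) auto
    also have "\<dots> = C2 * ((1 + ?M) * (1 + ?M) ^ 4) * (?R / rho q n)"
      unfolding C2_def using pos by (simp add: field_simps)
    also have "(1 + ?M) * (1 + ?M) ^ 4 = (1 + ?M) ^ 5" by (simp add: eval_nat_numeral)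
    also have "?R / rho q n = ?L / (?\<mu> * rho q n) + s_seq q n / rho q n"
      by (simp add: add_divide_distrib)
    finally show ?thesis by (simp only: R_def mult.assoc)
  qed
  \<comment> \<open>The test function 0 shows that the distance bounded by \<open>B n\<close> is
    nonnegative; so the ratios \<open>B n / R n\<close> summed in \<open>C\<close> are nonnegative
    too.\<close>
  have B_nonneg: "B n \<ge> 0" if "n \<ge> 3" for n
  proof -
    have "ereal 0 \<le> wasserstein (yaglom_law P \<xi> n) std_exponential"
      unfolding wasserstein_def
      by (rule SUP_upper2[of "\<lambda>_. 0"]) (auto simp: lipschitz_on_def)
    also have "\<dots> \<le> ereal (B n)"
      unfolding B_def by (rule wasserstein_le[OF gw]) (use that in \<open>auto intro: f1_le_sup_mean\<close>)
    finally show ?thesis by simp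
  qed
  have R_pos: "R n > 0" if "n \<ge> 3" "log_term q n > 0" for n
    unfolding R_def using that sup_mean_pos[of n] rho_pos[of n] mu_pos[of n] s_seq_nonneg[of n]
    by (intro mult_pos_pos add_pos_nonneg zero_less_power divide_pos_pos divide_nonneg_nonneg) auto
  define F where "F = {n \<in> {3..<k0 + 2}. log_term q n > 0}"
  define C where "C = C2 + (\<Sum>n\<in>F. B n / R n)"
  have term_nonneg: "B n / R n \<ge> 0" if "n \<in> F" for n
    using B_nonneg[of n] R_pos[of n] that by (simp add: F_def)
  have C_ge: "C \<ge> C2" unfolding C_def using term_nonneg by (simp add: sum_nonneg)
  have "B n \<le> C * R n" if n: "n \<ge> 3" "log_term q n > 0" for n
  proof (cases "n \<ge> k0 + 2")
    case True
    have "C2 * R n \<le> C * R n" using C_ge R_pos[OF n] by (intro mult_right_mono) auto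
    with large[OF True] show ?thesis by (rule order_trans)
  next
    case False
    then have "n \<in> F" using n by (simp add: F_def)
    then have "B n / R n \<le> (\<Sum>n\<in>F. B n / R n)"
      using term_nonneg by (intro member_le_sum) (auto simp: F_def)
    then have "B n / R n \<le> C" using C2 by (simp add: C_def)
    then show ?thesis using R_pos[OF n] by (simp add: pos_divide_le_eq)
  qed
  moreover have "wasserstein (yaglom_law P \<xi> n) std_exponential \<le> ereal (B n)" if "n \<ge> 3" for n
    unfolding B_def by (rule wasserstein_le[OF gw]) (use that in \<open>auto intro: f1_le_sup_mean\<close>)
  ultimately have "wasserstein (yaglom_law P \<xi> n) std_exponential \<le> ereal (C * R n)"
    if "n \<ge> 3" "log_term q n > 0" for n
    using that order_trans ereal_less_eq(3) by blast
  moreover have "C > 0" using C2 C_ge by simp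
  ultimately show ?thesis
    unfolding R_def mult.assoc by blast
qed

end

text \<open>Finiteness of the second moment is hidden in \<open>f2 q n \<ge> a > 0\<close>, because
  \<open>enn2real\<close> sends infinity to 0. The moment condition then makes the third moment
  finite, and replacing \<open>c\<close> by \<open>max c 1\<close> only weakens that
  condition.\<close>

lemma environmentI:
  assumes gw: "gwve P q \<xi>"
    and third: "\<And>n. n \<ge> 1 \<Longrightarrow>
      pgf_deriv 3 (q n) 1 \<le> ennreal c * pgf_deriv 2 (q n) 1 * (1 + pgf_deriv 1 (q n) 1)"
    and a: "a > 0" and f2: "\<And>n. n \<ge> 1 \<Longrightarrow> f2 q n \<ge> a" and c: "c > 0"
  shows "environment q a (max c 1)"
proof (rule environment.intro)
  fix n :: nat assume n: "n \<ge> 1"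
  interpret gwve P q \<xi> by (rule gw)
  have 1: "pgf_deriv 1 (q n) 1 = ennreal (measure_pmf.expectation (q n) real)"
    using nn_integral_eq_integral[OF offspring_mean_finite[OF n]] by (simp add: pgf_deriv_at_1)
  have f1: "f1 q n = measure_pmf.expectation (q n) real"
    unfolding f1_def 1 using offspring_mean_pos[OF n] by simp
  have 2: "pgf_deriv 2 (q n) 1 = ennreal (f2 q n)"
    using f2[OF n] a unfolding f2_def
    by (intro ennreal_enn2real[symmetric]) (metis enn2real_top infinity_ennreal_def le_less_trans less_irrefl not_less top.not_eq_extremum)
  let ?t = "enn2real (pgf_deriv 3 (q n) 1)"
  have le: "pgf_deriv 3 (q n) 1 \<le> ennreal (c * f2 q n * (1 + f1 q n))"
    using third[OF n] offspring_mean_pos[OF n] c f2[OF n] a unfolding 1 2 f1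
    by (simp add: ennreal_mult ennreal_plus)
  then have 3: "pgf_deriv 3 (q n) 1 = ennreal ?t"
    using ennreal_enn2real[of "pgf_deriv 3 (q n) 1"] by (metis ennreal_less_top le_less_trans)
  have nonneg: "c * f2 q n * (1 + f1 q n) \<ge> 0"
    using c f2[OF n] a offspring_mean_pos[OF n] f1 by simp
  show "offspring (q n) (f1 q n) (f2 q n) ?t (max c 1)"
  proof (rule offspring.intro)
    have "?t \<le> c * f2 q n * (1 + f1 q n)"
      using le nonneg by (subst (asm) 3) simp
    also have "\<dots> \<le> max c 1 * f2 q n * (1 + f1 q n)"
      using f2[OF n] a offspring_mean_pos[OF n] f1 by (intro mult_right_mono) auto
    finally show "?t \<le> max c 1 * f2 q n * (1 + f1 q n)" .
  qed (use 1 2 3 f1 f2[OF n] a offspring_mean_pos[OF n] in auto)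
qed (use a f2 in auto)

text \<open>For \<open>n\<close> with a nonpositive sum of logarithms the right-hand side may be
  negative, whereas a distance never is; hence the restriction on \<open>n\<close>.\<close>

theorem theorem1p5:
  fixes M :: "'w measure"
    and q :: "nat \<Rightarrow> nat pmf"
    and \<xi> :: "nat \<Rightarrow> nat \<Rightarrow> 'w \<Rightarrow> nat"
    and a c :: real
  assumes "gwve M q \<xi>"
    and "critical q"
    and "c > 0"
    and "\<And>n. n \<ge> 1 \<Longrightarrow>
      pgf_deriv 3 (q n) 1 \<le> ennreal c * pgf_deriv 2 (q n) 1 * (1 + pgf_deriv 1 (q n) 1)"
    and "a > 0"
    and "\<And>n. n \<ge> 1 \<Longrightarrow> f2 q n \<ge> a"
  shows "\<exists>C>0. \<forall>n\<ge>3. ln (mu q n * rho q n) + ln (f1 q n) > 0 \<longrightarrow>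
    wasserstein (yaglom_law M \<xi> n) std_exponential
      \<le> ereal (C * (1 + sup_mean q n) ^ 5 *
          ((ln (mu q n * rho q n) + ln (f1 q n)) / (mu q n * rho q n) + s_seq q n / rho q n))"
proof -
  interpret environment q a "max c 1"
    by (rule environmentI) (use assms in auto)
  show ?thesis
    using wasserstein_rate[OF assms(1)] assms(2)
    by (simp add: critical_def log_term_def mult.commute[of "rho q _"])
qed

end
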